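(* Let $p$ be an odd prime and let $G$ be a $p$-group of order $p^m$ of rank $5$ belonging to the isoclinism family $\Phi_{10}$. Then (1) $\displaystyle A_G(t/|G|)=\frac{1-p^{-1}}{1-p^{-3}t} + \frac{p^{-1}-p^{-3}}{1-p^{-2}t} + \frac{p^{-3}-p^{-4}}{1-p^{-1}t} + \frac{p^{-4}}{1-t}$; (2) $\displaystyle B_G(t/|G|)=\frac{-p^{-1}}{1-p^{-4}t}+\frac{1-p^{-2}}{1-p^{-3}t}+\frac{p^{-1}+p^{-2}}{1-p^{-2}t}$.
   Context: For a finite group $G$ and $n\ge 0$, $\alpha_{G,n}$ denotes the number of orbits of $G$ acting on $G^n$ by simultaneous conjugation $g\cdot(x_1,\dots,x_n)=(gx_1g^{-1},\dots,gx_ng^{-1})$, and $\beta_{G,n}$ denotes the number of orbits of the same action on the set $G^{(n)}$ of $n$-tuples of pairwise commuting elements of $G$; $\alpha_{G,0}=\beta_{G,0}=1$. Set $A_G(t)=\sum_{n\ge 0}\alpha_{G,n}t^n$ and $B_G(t)=\sum_{n\ge 0}\beta_{G,n}t^n$ (formal power series, which are rational functions of $t$). $A_G(t/|G|)$, $B_G(t/|G|)$ denote the result of substituting $t/|G|$ for $t$. Finite groups $G,H$ are isoclinic if there are isomorphisms $\theta:G/Z(G)\to H/Z(H)$ and $\phi:G'\to H'$ (derived subgroups) such that $\phi([g_1,g_2])=[h_1,h_2]$ whenever $\theta(g_iZ(G))=h_iZ(H)$ for $i=1,2$. Isoclinism is an equivalence relation, whose classes are called isoclinism families. For a $p$-group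 $G$, the rank of (the family of) $G$ is the smallest $r$ such that the isoclinism family of $G$ contains a group of order $p^r$. $\Phi_{10}$ (James's notation) is the isoclinism family, of rank 5, of the group of order $p^5$ $$\Phi_{10}(1^5)=\langle \alpha, \alpha_1,\alpha_2,\alpha_3, \alpha_4\mid[\alpha_i,\alpha]=\alpha_{i+1},\ [\alpha_1,\alpha_2]=\alpha_4,\ \alpha^p=\alpha_1^{(p)}=\alpha_{i+1}^{(p)}=1\ (i=1,2,3) \rangle ,$$ where $\alpha_{i+1}^{(p)}$ denotes $\alpha_{i+1}^p\alpha_{i+2}^{\binom p2}\cdots \alpha_{i+p}^{\binom pp}$ for $i\ge 0$, with $\alpha_j=1$ for $j>4$. Here $[x,y]=x^{-1}y^{-1}xy$, and by convention all pairs of generators whose commutator is not listed commute. $G$ belongs to $\Phi_{10}$ if $G$ is a finite $p$-group isoclinic to this group. *)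

theory Defs
  imports
    "HOL-Algebra.Group_Action"
    "HOL-Algebra.Generated_Groups"
    "HOL-Computational_Algebra.Formal_Power_Series"
    "HOL-Computational_Algebra.Primes"
begin

section \<open>Orbits of simultaneous conjugation\<close>

definition tuples :: "('a, 'b) monoid_scheme \<Rightarrow> nat \<Rightarrow> 'a list set" where
  "tuples G n = {xs. length xs = n \<and> set xs \<subseteq> carrier G}"

definition commuting_tuples :: "('a, 'b) monoid_scheme \<Rightarrow> nat \<Rightarrow> 'a list set" where
  "commuting_tuples G n =
     {xs \<in> tuples G n. \<forall>i<n. \<forall>j<n. xs ! i \<otimes>\<^bsub>G\<^esub> xs ! j = xs ! j \<otimes>\<^bsub>G\<^esub> xs ! i}"

definition conj_tuple :: "('a, 'b) monoid_scheme \<Rightarrow> 'a \<Rightarrow> 'a list \<Rightarrow> 'a list" where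
  "conj_tuple G g xs = map (\<lambda>x. g \<otimes>\<^bsub>G\<^esub> x \<otimes>\<^bsub>G\<^esub> inv\<^bsub>G\<^esub> g) xs"

definition alpha :: "('a, 'b) monoid_scheme \<Rightarrow> nat \<Rightarrow> nat" where
  "alpha G n = card (orbits G (tuples G n) (conj_tuple G))"

definition beta :: "('a, 'b) monoid_scheme \<Rightarrow> nat \<Rightarrow> nat" where
  "beta G n = card (orbits G (commuting_tuples G n) (conj_tuple G))"

definition A_fps :: "('a, 'b) monoid_scheme \<Rightarrow> real fps" where
  "A_fps G = Abs_fps (\<lambda>n. real (alpha G n))"

definition B_fps :: "('a, 'b) monoid_scheme \<Rightarrow> real fps" where
  "B_fps G = Abs_fps (\<lambda>n. real (beta G n))"


section \<open>Isoclinism\<close>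

definition center :: "('a, 'b) monoid_scheme \<Rightarrow> 'a set" where
  "center G = {z \<in> carrier G. \<forall>g \<in> carrier G. g \<otimes>\<^bsub>G\<^esub> z = z \<otimes>\<^bsub>G\<^esub> g}"

definition commutator :: "('a, 'b) monoid_scheme \<Rightarrow> 'a \<Rightarrow> 'a \<Rightarrow> 'a" where
  "commutator G x y = inv\<^bsub>G\<^esub> x \<otimes>\<^bsub>G\<^esub> inv\<^bsub>G\<^esub> y \<otimes>\<^bsub>G\<^esub> x \<otimes>\<^bsub>G\<^esub> y"

text \<open>
  \<^const>\<open>derived\<close> is generated by the elements $x y x^{-1} y^{-1}$; these are the commutators
  $[x^{-1}, y^{-1}]$ in the convention above, so it is the same derived subgroup.
\<close>

definition derived_group :: "('a, 'b) monoid_scheme \<Rightarrow> ('a, 'b) monoid_scheme" where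
  "derived_group G = G\<lparr>carrier := derived G (carrier G)\<rparr>"

definition isoclinic :: "('a, 'b) monoid_scheme \<Rightarrow> ('c, 'd) monoid_scheme \<Rightarrow> bool" where
  "isoclinic G H \<longleftrightarrow>
     (\<exists>\<theta> \<in> iso (G Mod center G) (H Mod center H).
      \<exists>\<phi> \<in> iso (derived_group G) (derived_group H).
        \<forall>g1 \<in> carrier G. \<forall>g2 \<in> carrier G. \<forall>h1 \<in> carrier H. \<forall>h2 \<in> carrier H.
          \<theta> (center G #>\<^bsub>G\<^esub> g1) = center H #>\<^bsub>H\<^esub> h1 \<longrightarrow>
          \<theta> (center G #>\<^bsub>G\<^esub> g2) = center H #>\<^bsub>H\<^esub> h2 \<longrightarrow>
          \<phi> (commutator G g1 g2) = commutator H h1 h2)"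

text \<open>
  Every finite group is isomorphic to one with carrier in \<^typ>\<open>nat\<close>, so nothing is lost by
  letting the competitors \<open>H\<close> range over groups on that type.
\<close>

definition isoclinism_rank :: "nat \<Rightarrow> ('a, 'b) monoid_scheme \<Rightarrow> nat" where
  "isoclinism_rank p G =
     (LEAST r. \<exists>H :: nat monoid. group H \<and> Coset.order H = p ^ r \<and> isoclinic G H)"


section \<open>Groups given by generators and relators\<close>

text \<open>
  The generators are the elements of the type \<open>'a\<close>; the letter \<open>(x, True)\<close> stands for $x$ and
  \<open>(x, False)\<close> for $x^{-1}$.
\<close>

type_synonym 'a word = "('a \<times> bool) list"

inductive pres_eq :: "'a word set \<Rightarrow> 'a word \<Rightarrow> 'a word \<Rightarrow> bool" for R where
  refl: "pres_eq R u u"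
| sym: "pres_eq R u v \<Longrightarrow> pres_eq R v u"
| trans: "pres_eq R u v \<Longrightarrow> pres_eq R v w \<Longrightarrow> pres_eq R u w"
| cancel: "pres_eq R (u @ [(x, b), (x, \<not> b)] @ v) (u @ v)"
| relator: "r \<in> R \<Longrightarrow> pres_eq R (u @ r @ v) (u @ v)"

definition presented_group :: "'a word set \<Rightarrow> 'a word set monoid" where
  "presented_group R =
     \<lparr>carrier = UNIV // {(u, v). pres_eq R u v},
      monoid.mult = (\<lambda>X Y. {w. \<exists>u\<in>X. \<exists>v\<in>Y. pres_eq R (u @ v) w}),
      monoid.one = {w. pres_eq R [] w}\<rparr>"

definition word_inv :: "'a word \<Rightarrow> 'a word" where
  "word_inv w = rev (map (\<lambda>(x, b). (x, \<not> b)) w)"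

definition word_comm :: "'a word \<Rightarrow> 'a word \<Rightarrow> 'a word" where
  "word_comm u v = word_inv u @ word_inv v @ u @ v"

definition word_pow :: "'a word \<Rightarrow> nat \<Rightarrow> 'a word" where
  "word_pow w n = concat (replicate n w)"

lemma pres_eq_append:
  assumes "pres_eq R u u'" "pres_eq R v v'"
  shows "pres_eq R (u @ v) (u' @ v')"
proof -
  have "pres_eq R (a @ u @ b) (a @ u' @ b)" if "pres_eq R u u'" for a b u u'
    using that
  proof (induction rule: pres_eq.induct)
    case (cancel u x c v)
    then show ?case using pres_eq.cancel[of R "a @ u" x c "v @ b"] by simp
  next
    case (relator r u v)
    then show ?case using pres_eq.relator[of r R "a @ u" "v @ b"] by simp
  qed (auto intro: pres_eq.intros)
  from this[OF assms(1), of "[]" v] this[OF assms(2), of u' "[]"]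
  show ?thesis by (auto intro: pres_eq.trans)
qed

lemma pres_eq_word_inv: "pres_eq R (word_inv w @ w) []"
proof (induction w)
  case Nil
  then show ?case by (simp add: word_inv_def pres_eq.refl)
next
  case (Cons a w)
  obtain x b where a: "a = (x, b)" by (cases a)
  have "word_inv (a # w) @ a # w = word_inv w @ [(x, \<not> b), (x, \<not> \<not> b)] @ w"
    by (simp add: word_inv_def a)
  then show ?case using pres_eq.cancel[of R "word_inv w" x "\<not> b" w] Cons
    by (metis pres_eq.trans)
qed

lemma mult_presented_group:
  "{w. pres_eq R u w} \<otimes>\<^bsub>presented_group R\<^esub> {w. pres_eq R v w} = {w. pres_eq R (u @ v) w}"
  by (auto simp: presented_group_def
      intro: pres_eq.refl pres_eq.trans pres_eq_append)

lemma carrier_presented_group: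
  "carrier (presented_group R) = {{w. pres_eq R u w} | u. True}"
  by (auto simp: presented_group_def quotient_def)

lemma group_presented_group: "group (presented_group R)"
proof (rule groupI)
  have one: "\<one>\<^bsub>presented_group R\<^esub> = {w. pres_eq R [] w}"
    by (simp add: presented_group_def)
  then show "\<one>\<^bsub>presented_group R\<^esub> \<in> carrier (presented_group R)"
    by (auto simp: carrier_presented_group)
  fix X assume "X \<in> carrier (presented_group R)"
  then obtain u where X: "X = {w. pres_eq R u w}" by (auto simp: carrier_presented_group)
  show "\<one>\<^bsub>presented_group R\<^esub> \<otimes>\<^bsub>presented_group R\<^esub> X = X"
    unfolding X one mult_presented_group by simp
  have "{w. pres_eq R (word_inv u) w} \<otimes>\<^bsub>presented_group R\<^esub> X = \<one>\<^bsub>presented_group R\<^esub>"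
    unfolding X one mult_presented_group
    using pres_eq_word_inv[of R u] by (auto intro: pres_eq.sym pres_eq.trans)
  then show "\<exists>Y \<in> carrier (presented_group R).
      Y \<otimes>\<^bsub>presented_group R\<^esub> X = \<one>\<^bsub>presented_group R\<^esub>"
    by (auto simp: carrier_presented_group)
qed (auto simp: carrier_presented_group mult_presented_group)


section \<open>The isoclinism family $\Phi_{10}$\<close>

datatype phi10_gen = Al | Al1 | Al2 | Al3 | Al4

text \<open>\<open>al j\<close> is the word $\alpha_j$, with $\alpha_j = 1$ for $j > 4$ (the index 0 is not used).\<close>

definition al :: "nat \<Rightarrow> phi10_gen word" where
  "al j = (if j = 1 then [(Al1, True)] else if j = 2 then [(Al2, True)]
           else if j = 3 then [(Al3, True)] else if j = 4 then [(Al4, True)] else [])"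

text \<open>
  \<open>al_ppow p i\<close> is the word
  $\alpha_{i+1}^{(p)} = \alpha_{i+1}^p \alpha_{i+2}^{\binom p2} \cdots \alpha_{i+p}^{\binom pp}$;
  beware that its index is shifted: \<open>i = 0\<close> gives $\alpha_1^{(p)}$.
\<close>

definition al_ppow :: "nat \<Rightarrow> nat \<Rightarrow> phi10_gen word" where
  "al_ppow p i = concat (map (\<lambda>k. word_pow (al (i + k)) (p choose k)) [1..<Suc p])"

text \<open>
  The third and fourth sets spell out the convention that pairs of generators whose commutator
  is not listed commute.
\<close>

definition phi10_relators :: "nat \<Rightarrow> phi10_gen word set" where
  "phi10_relators p =
     {word_comm (al i) [(Al, True)] @ word_inv (al (i + 1)) | i. i \<in> {1, 2, 3}} \<union>
     {word_comm (al 1) (al 2) @ word_inv (al 4)} \<union>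
     {word_comm (al 4) [(Al, True)]} \<union>
     {word_comm (al i) (al j) | i j. (i, j) \<in> {(1, 3), (1, 4), (2, 3), (2, 4), (3, 4)}} \<union>
     {word_pow [(Al, True)] p} \<union>
     {al_ppow p i | i. i \<in> {0, 1, 2, 3}}"

definition Phi10_group :: "nat \<Rightarrow> phi10_gen word set monoid" where
  "Phi10_group p = presented_group (phi10_relators p)"

definition in_Phi10 :: "nat \<Rightarrow> ('a, 'b) monoid_scheme \<Rightarrow> bool" where
  "in_Phi10 p G \<longleftrightarrow>
     group G \<and> (\<exists>k. Coset.order G = p ^ k) \<and> isoclinic G (Phi10_group p)"

end

theory Submission imports Defs "HOL-Algebra.Multiplicative_Group" begin

text \<open>
  By Burnside's lemma, $|G|\,\alpha_{G,n} = \sum_g |C_G(g)|^n$, and $|G|\,\beta_{G,n}$ is the number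
  of commuting $(n+1)$-tuples. Both depend only on the commutation relation on $G/Z(G)$ and on
  $|Z(G)|$, and an isoclinism preserves that relation, so it suffices to know the
  centralizers in $H = \Phi_{10}(1^5)$. Let $Z < D < E < A < H$ be generated by the last
  $1, \dots, 4$ of the generators $\alpha_1, \dots, \alpha_4$; each has index $p$ in the
  next. The centralizer of $g \in D \setminus Z$ is $A$; that of $g \in A \setminus D$ is abelian of order
  $p^3$ and lies in $A$; that of $g \notin A$ is abelian of order $p^2$.

  That $H$ does not collapse, that is, $\alpha_4 \neq 1$, follows from the rank: if
  $\alpha_4 = 1$ then $|H|$ divides $p^4$, so $G$ would have rank at most $4$.
\<close>

section \<open>Counting commuting tuples\<close>

text \<open>No multiplication table of the group H is computed. Its flag is built by adjoining one
  generator at a time to a subgroup that it normalizes, and the centralizers are found by index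
  arguments: a subgroup that properly contains one of prime index is everything. The crux is that an
  x outside A commutes with nothing in A outside Z. Such a y would drop from A to E, from E to D and
  from D to Z: if [y, x] vanished modulo the right term of the flag, then y would commute with
  \<alpha> too modulo that term, and so would the generator \<alpha>_i at the top of its layer,
  against [\<alpha>_i, \<alpha>] = \<alpha>_{i+1}.

  Isoclinism supplies no homomorphism from G to H, only one between the central quotients. A choice
  of coset representatives is a mere function from G to H, but it preserves and reflects
  commutation, and preimages of subgroups above Z have the expected size. The counting is therefore
  done with bare subsets of G, whose sizes are a power of p times w = |Z(G)|. Since |G| = p^4 w, the
  substitution t/|G| cancels w, which is why m does not show up in the result.\<close>

definition comm_lists :: "('a \<Rightarrow> 'a \<Rightarrow> bool) \<Rightarrow> 'a set \<Rightarrow> nat \<Rightarrow> 'a list set" where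
  "comm_lists R S n = {xs. length xs = n \<and> set xs \<subseteq> S \<and> (\<forall>x\<in>set xs. \<forall>y\<in>set xs. R x y)}"

lemma finite_comm_lists: "finite S \<Longrightarrow> finite (comm_lists R S n)"
  by (rule finite_subset[OF _ finite_lists_length_eq[of S n]]) (auto simp: comm_lists_def)

lemma comm_lists_0 [simp]: "comm_lists R S 0 = {[]}"
  by (auto simp: comm_lists_def)

text \<open>Splitting off the first entry leaves a list inside its centralizer. Relation and ground
  set are abstract so that this recursion can be iterated down a chain of centralizers.\<close>

lemma card_comm_lists_Suc:
  assumes "finite S" "\<And>x. x \<in> S \<Longrightarrow> R x x" "\<And>x y. x \<in> S \<Longrightarrow> y \<in> S \<Longrightarrow> R x y \<Longrightarrow> R y x"
  shows "card (comm_lists R S (Suc n)) = (\<Sum>x\<in>S. card (comm_lists R {y \<in> S. R x y} n))"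
proof -
  have "comm_lists R S (Suc n) =
      (\<lambda>(x, xs). x # xs) ` (SIGMA x:S. comm_lists R {y \<in> S. R x y} n)" (is "?L = ?R")
  proof
    show "?L \<subseteq> ?R"
    proof
      fix ys assume "ys \<in> ?L"
      then obtain x xs where "ys = x # xs" "x \<in> S" "xs \<in> comm_lists R {y \<in> S. R x y} n"
        by (cases ys) (auto simp: comm_lists_def)
      then show "ys \<in> ?R" by force
    qed
    show "?R \<subseteq> ?L" using assms(2,3) by (fastforce simp: comm_lists_def)
  qed
  moreover have "inj_on (\<lambda>(x, xs). x # xs) (SIGMA x:S. comm_lists R {y \<in> S. R x y} n)"
    by (auto simp: inj_on_def)
  ultimately have "card (comm_lists R S (Suc n)) =
      card (SIGMA x:S. comm_lists R {y \<in> S. R x y} n)"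
    by (simp add: card_image)
  also have "\<dots> = (\<Sum>x\<in>S. card (comm_lists R {y \<in> S. R x y} n))"
    using assms(1) by (subst card_SigmaI) (auto simp: finite_comm_lists)
  finally show ?thesis .
qed

lemma card_comm_lists_pairwise:
  assumes "finite S" "\<And>x y. x \<in> S \<Longrightarrow> y \<in> S \<Longrightarrow> R x y"
  shows "card (comm_lists R S n) = card S ^ n"
proof -
  have "comm_lists R S n = {xs. set xs \<subseteq> S \<and> length xs = n}"
    using assms(2) by (auto simp: comm_lists_def)
  then show ?thesis using card_lists_length_eq[OF assms(1)] by simp
qed

text \<open>The centralizer pattern of the overview, scaled by w, the order of the centre. The sets
  carry no group structure because they will be preimages under a function that need not be a
  homomorphism. E has no counterpart: elements of A - E and of E - D have centralizers of the same
  order, so the counts do not tell them apart.\<close>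

locale commuting_flag =
  fixes R :: "'a \<Rightarrow> 'a \<Rightarrow> bool" and X A D Z :: "'a set" and p w :: nat
  assumes finite_X: "finite X"
    and refl: "x \<in> X \<Longrightarrow> R x x"
    and sym: "x \<in> X \<Longrightarrow> y \<in> X \<Longrightarrow> R x y \<Longrightarrow> R y x"
    and subsets: "Z \<subseteq> D" "D \<subseteq> A" "A \<subseteq> X"
    and cards: "card Z = w" "card D = p * w" "card A = p ^ 3 * w" "card X = p ^ 4 * w"
    and central: "x \<in> Z \<Longrightarrow> y \<in> X \<Longrightarrow> R x y"
    and cent_D: "x \<in> D - Z \<Longrightarrow> {y \<in> X. R x y} = A"
    and cent_A: "x \<in> A - D \<Longrightarrow> {y \<in> X. R x y} \<subseteq> A"
      "x \<in> A - D \<Longrightarrow> card {y \<in> X. R x y} = p\<^sup>2 * w"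
      "x \<in> A - D \<Longrightarrow> y \<in> X \<Longrightarrow> z \<in> X \<Longrightarrow> R x y \<Longrightarrow> R x z \<Longrightarrow> R y z"
    and cent_X: "x \<in> X - A \<Longrightarrow> card {y \<in> X. R x y} = p * w"
      "x \<in> X - A \<Longrightarrow> y \<in> X \<Longrightarrow> z \<in> X \<Longrightarrow> R x y \<Longrightarrow> R x z \<Longrightarrow> R y z"
begin

lemma finite_subs: "finite A" "finite D" "finite Z"
  using finite_X subsets by (meson finite_subset)+

lemma sum_A_cases:
  fixes h :: "'a \<Rightarrow> real"
  assumes "\<And>x. x \<in> D \<Longrightarrow> h x = b" "\<And>x. x \<in> A - D \<Longrightarrow> h x = c"
  shows "sum h A = real p * w * b + (real p ^ 3 * w - real p * w) * c"
proof -
  have "sum h A = sum h D + sum h (A - D)"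
    using sum.subset_diff[OF subsets(2) finite_subs(1), of h] by simp
  moreover have "real (card (A - D)) = real p ^ 3 * w - real p * w"
    using card_Diff_subset[OF finite_subs(2) subsets(2)] card_mono[OF finite_subs(1) subsets(2)]
    by (simp add: cards of_nat_diff)
  ultimately show ?thesis using assms by (simp add: cards)
qed

lemma sum_X_cases:
  fixes h :: "'a \<Rightarrow> real"
  assumes "\<And>x. x \<in> Z \<Longrightarrow> h x = a" "\<And>x. x \<in> D - Z \<Longrightarrow> h x = b"
    "\<And>x. x \<in> A - D \<Longrightarrow> h x = c" "\<And>x. x \<in> X - A \<Longrightarrow> h x = d"
  shows "sum h X = real w * a + (real p * w - w) * b + (real p ^ 3 * w - real p * w) * c
    + (real p ^ 4 * w - real p ^ 3 * w) * d"
proof -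
  have "sum h X = sum h Z + sum h (D - Z) + sum h (A - D) + sum h (X - A)"
    using sum.subset_diff[OF subsets(1) finite_subs(2), of h]
      sum.subset_diff[OF subsets(2) finite_subs(1), of h]
      sum.subset_diff[OF subsets(3) finite_X, of h] by simp
  moreover have "real (card (A - D)) = real p ^ 3 * w - real p * w"
    using card_Diff_subset[OF finite_subs(2) subsets(2)] card_mono[OF finite_subs(1) subsets(2)]
    by (simp add: cards of_nat_diff)
  moreover have "real (card (D - Z)) = real p * w - w"
    using card_Diff_subset[OF finite_subs(3) subsets(1)] card_mono[OF finite_subs(2) subsets(1)]
    by (simp add: cards of_nat_diff)
  moreover have "real (card (X - A)) = real p ^ 4 * w - real p ^ 3 * w"
    using card_Diff_subset[OF finite_subs(1) subsets(3)] card_mono[OF finite_X subsets(3)]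
    by (simp add: cards of_nat_diff)
  ultimately show ?thesis using assms by (simp add: cards)
qed

lemma sum_card_cent_power:
  "(\<Sum>x\<in>X. real (card {y \<in> X. R x y} ^ n)) =
    w * (real p ^ 4 * w) ^ n + (real p * w - w) * (real p ^ 3 * w) ^ n
    + (real p ^ 3 * w - real p * w) * (real p ^ 2 * w) ^ n
    + (real p ^ 4 * w - real p ^ 3 * w) * (real p * w) ^ n"
proof (rule sum_X_cases)
  fix x assume "x \<in> Z"
  then have "{y \<in> X. R x y} = X" using central by auto
  then show "real (card {y \<in> X. R x y} ^ n) = (real p ^ 4 * w) ^ n" by (simp add: cards)
qed (simp_all add: cent_D cards cent_A(2) cent_X(1))

text \<open>With c_n the left side, c_{n+1} = p w c_n + (p^3 - p) w (p^2 w)^n. The particular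
  solution has coefficient (p^3 - p)/(p^2 - p) = p + 1, and c_0 = 1 fixes the coefficient -p of the
  homogeneous solution.\<close>

lemma card_comm_lists_A:
  "real (card (comm_lists R A n)) = (real p + 1) * (real p ^ 2 * w) ^ n - real p * (real p * w) ^ n"
proof (induction n)
  case (Suc n)
  have "real (card (comm_lists R A (Suc n))) =
      (\<Sum>x\<in>A. real (card (comm_lists R {y \<in> A. R x y} n)))"
    using subsets by (subst card_comm_lists_Suc) (auto intro: refl sym finite_subs)
  also have "\<dots> = real p * w * real (card (comm_lists R A n))
      + (real p ^ 3 * w - real p * w) * (real p ^ 2 * w) ^ n"
  proof (rule sum_A_cases)
    fix x assume x: "x \<in> D"
    then have "{y \<in> A. R x y} = A"
      using cent_D[of x] central[of x] subsets by (cases "x \<in> Z") auto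
    then show "real (card (comm_lists R {y \<in> A. R x y} n)) = real (card (comm_lists R A n))"
      by simp
  next
    fix x assume x: "x \<in> A - D"
    then have "{y \<in> A. R x y} = {y \<in> X. R x y}"
      using cent_A(1)[OF x] subsets by auto
    moreover have "card (comm_lists R {y \<in> X. R x y} n) = card {y \<in> X. R x y} ^ n"
      using cent_A(3)[OF x] finite_X by (intro card_comm_lists_pairwise) auto
    ultimately show "real (card (comm_lists R {y \<in> A. R x y} n)) = (real p ^ 2 * w) ^ n"
      by (simp add: cent_A(2)[OF x])
  qed
  also have "\<dots> = (real p + 1) * (real p ^ 2 * w) ^ Suc n - real p * (real p * w) ^ Suc n"
    unfolding Suc by (simp add: algebra_simps power2_eq_square power3_eq_cube)
  finally show ?case .
qed simp

text \<open>The same kind of recursion, now with homogeneous solution w^n and the count over A as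
  part of the inhomogeneity. Comparing coefficients of (p^2 w)^n and (p w)^n gives p + 1 and p^3 -
  p; the value 1 at n = 0 gives -p^3.\<close>

lemma card_comm_lists_X:
  "real (card (comm_lists R X n)) = (real p + 1) * (real p ^ 2 * w) ^ n
    + (real p ^ 3 - real p) * (real p * w) ^ n - real p ^ 3 * real w ^ n"
proof (induction n)
  case (Suc n)
  have "real (card (comm_lists R X (Suc n))) =
      (\<Sum>x\<in>X. real (card (comm_lists R {y \<in> X. R x y} n)))"
    by (subst card_comm_lists_Suc) (auto intro: refl sym finite_X)
  also have "\<dots> = w * real (card (comm_lists R X n)) + (real p * w - w) * real (card (comm_lists R A n))
      + (real p ^ 3 * w - real p * w) * (real p ^ 2 * w) ^ n
      + (real p ^ 4 * w - real p ^ 3 * w) * (real p * w) ^ n"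
  proof (rule sum_X_cases)
    fix x assume "x \<in> Z"
    then have "{y \<in> X. R x y} = X" using central by auto
    then show "real (card (comm_lists R {y \<in> X. R x y} n)) = real (card (comm_lists R X n))"
      by simp
  next
    fix x assume x: "x \<in> A - D"
    have "card (comm_lists R {y \<in> X. R x y} n) = card {y \<in> X. R x y} ^ n"
      using cent_A(3)[OF x] finite_X by (intro card_comm_lists_pairwise) auto
    then show "real (card (comm_lists R {y \<in> X. R x y} n)) = (real p ^ 2 * w) ^ n"
      by (simp add: cent_A(2)[OF x])
  next
    fix x assume x: "x \<in> X - A"
    have "card (comm_lists R {y \<in> X. R x y} n) = card {y \<in> X. R x y} ^ n"
      using cent_X(2)[OF x] finite_X by (intro card_comm_lists_pairwise) auto
    then show "real (card (comm_lists R {y \<in> X. R x y} n)) = (real p * w) ^ n"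
      by (simp add: cent_X(1)[OF x])
  qed (simp add: cent_D)
  also have "\<dots> = (real p + 1) * (real p ^ 2 * w) ^ Suc n
    + (real p ^ 3 - real p) * (real p * w) ^ Suc n - real p ^ 3 * real w ^ Suc n"
    unfolding Suc card_comm_lists_A
    by (simp add: algebra_simps power2_eq_square power3_eq_cube power4_eq_xxxx)
  finally show ?case .
qed simp

end

text \<open>Turns each partial fraction into an explicit sequence, so that the identities of series
  can be checked coefficient by coefficient.\<close>

lemma fps_const_over_geometric:
  "fps_const a / (1 - fps_const c * fps_X) = Abs_fps (\<lambda>n. a * c ^ n :: 'a::field)"
proof -
  have "Abs_fps (\<lambda>n. 1) oo (fps_const c * fps_X) = 1 / (1 - fps_const c * fps_X)"
    by (rule gp) simp
  then have "inverse (1 - fps_const c * fps_X) = Abs_fps (\<lambda>n. c ^ n)"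
    by (simp add: fps_compose_linear fps_divide_unit)
  then show ?thesis by (simp add: fps_divide_unit fps_eq_iff)
qed

section \<open>Orbits of simultaneous conjugation\<close>

context group
begin

lemma conj_tuple_mult:
  assumes "g \<in> carrier G" "h \<in> carrier G" "set xs \<subseteq> carrier G"
  shows "conj_tuple G (g \<otimes> h) xs = conj_tuple G g (conj_tuple G h xs)"
  using assms by (auto simp: conj_tuple_def inv_mult_group m_assoc subset_iff)

lemma conj_tuple_one: "set xs \<subseteq> carrier G \<Longrightarrow> conj_tuple G \<one> xs = xs"
  by (auto simp: conj_tuple_def subset_iff intro!: map_idI)

lemma conj_tuple_fixed_iff:
  assumes "g \<in> carrier G" "set xs \<subseteq> carrier G"
  shows "conj_tuple G g xs = xs \<longleftrightarrow> (\<forall>x\<in>set xs. g \<otimes> x = x \<otimes> g)"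
proof -
  have "g \<otimes> x \<otimes> inv g = x \<longleftrightarrow> g \<otimes> x = x \<otimes> g" if "x \<in> carrier G" for x
    using that assms(1) by (metis inv_solve_right m_closed)
  then have "(\<forall>x\<in>set xs. g \<otimes> x \<otimes> inv g = x) \<longleftrightarrow> (\<forall>x\<in>set xs. g \<otimes> x = x \<otimes> g)"
    using assms(2) by blast
  then show ?thesis
    using map_eq_conv[of "\<lambda>x. g \<otimes> x \<otimes> inv g" xs "\<lambda>x. x"]
    by (simp add: conj_tuple_def)
qed

text \<open>The invariant set E stays arbitrary so that all tuples and commuting tuples are treated
  at once.\<close>

lemma conj_tuple_burnside:
  assumes fin: "finite (carrier G)" and E: "finite E" "\<And>xs. xs \<in> E \<Longrightarrow> set xs \<subseteq> carrier G"
    and closed: "\<And>g xs. g \<in> carrier G \<Longrightarrow> xs \<in> E \<Longrightarrow> conj_tuple G g xs \<in> E"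
  shows "card (orbits G E (conj_tuple G)) * Coset.order G =
    (\<Sum>g\<in>carrier G. card {xs \<in> E. \<forall>x\<in>set xs. g \<otimes> x = x \<otimes> g})"
proof -
  \<comment> \<open>Elements of \<open>BijGroup E\<close> are extensional functions, hence the
    restriction; the orbits do not change.\<close>
  define \<phi> where "\<phi> = (\<lambda>g. restrict (conj_tuple G g) E)"
  have bij: "bij_betw (conj_tuple G g) E E" if "g \<in> carrier G" for g
  proof (rule bij_betwI[where g = "conj_tuple G (inv g)"])
    fix xs assume "xs \<in> E"
    then show "conj_tuple G (inv g) (conj_tuple G g xs) = xs"
      "conj_tuple G g (conj_tuple G (inv g) xs) = xs"
      using that E(2) by (simp_all add: conj_tuple_one flip: conj_tuple_mult)
  qed (use closed that in auto)
  interpret group_action G E \<phi>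
  proof (rule group_action.intro, rule group_hom.intro)
    show "group (BijGroup E)" by (rule group_BijGroup)
    show "group_hom_axioms G (BijGroup E) \<phi>"
    proof (unfold group_hom_axioms_def, rule homI)
      fix g assume g: "g \<in> carrier G"
      show "\<phi> g \<in> carrier (BijGroup E)"
        using bij[OF g] by (auto simp: BijGroup_def Bij_def \<phi>_def cong: bij_betw_cong)
      fix h assume h: "h \<in> carrier G"
      have "restrict (conj_tuple G k) E \<in> Bij E" if "k \<in> carrier G" for k
        using bij[OF that] by (auto simp: Bij_def cong: bij_betw_cong)
      then show "\<phi> (g \<otimes> h) = \<phi> g \<otimes>\<^bsub>BijGroup E\<^esub> \<phi> h"
        using g h E(2) closed
        by (auto simp: BijGroup_def \<phi>_def compose_def conj_tuple_mult fun_eq_iff)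
    qed
  qed (rule is_group)
  have "orbits G E \<phi> = orbits G E (conj_tuple G)"
    unfolding orbits_def orbit_def \<phi>_def by (auto cong: conj_cong)
  moreover have "invariants E \<phi> g = {xs \<in> E. \<forall>x\<in>set xs. g \<otimes> x = x \<otimes> g}"
    if "g \<in> carrier G" for g
    using that E(2) by (auto simp: invariants_def \<phi>_def conj_tuple_fixed_iff)
  ultimately show ?thesis using burnside[OF fin E(1)] by simp
qed

abbreviation commute :: "'a \<Rightarrow> 'a \<Rightarrow> bool" where "commute x y \<equiv> x \<otimes> y = y \<otimes> x"

lemma alpha_burnside:
  assumes "finite (carrier G)"
  shows "alpha G n * Coset.order G = (\<Sum>g\<in>carrier G. card {x \<in> carrier G. commute g x} ^ n)"
proof -
  have fin: "finite (tuples G n)"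
    using finite_lists_length_eq[OF assms, of n] by (simp add: tuples_def conj_ac)
  have "alpha G n * Coset.order G =
      (\<Sum>g\<in>carrier G. card {xs \<in> tuples G n. \<forall>x\<in>set xs. commute g x})"
    unfolding alpha_def using assms fin
    by (rule conj_tuple_burnside) (auto simp: tuples_def conj_tuple_def)
  also have "\<dots> = (\<Sum>g\<in>carrier G. card {x \<in> carrier G. commute g x} ^ n)"
  proof (rule sum.cong[OF HOL.refl])
    fix g
    have "{xs \<in> tuples G n. \<forall>x\<in>set xs. commute g x} =
        {xs. set xs \<subseteq> {x \<in> carrier G. commute g x} \<and> length xs = n}"
      by (auto simp: tuples_def)
    then show "card {xs \<in> tuples G n. \<forall>x\<in>set xs. commute g x} =
        card {x \<in> carrier G. commute g x} ^ n"
      using assms by (simp add: card_lists_length_eq)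
  qed
  finally show ?thesis .
qed

lemma commuting_tuples_eq: "commuting_tuples G n = comm_lists commute (carrier G) n"
  by (auto simp: commuting_tuples_def tuples_def comm_lists_def all_set_conv_all_nth)

lemma commute_conj:
  assumes "g \<in> carrier G" "x \<in> carrier G" "y \<in> carrier G" "commute x y"
  shows "commute (g \<otimes> x \<otimes> inv g) (g \<otimes> y \<otimes> inv g)"
proof -
  have "g \<otimes> a \<otimes> inv g \<otimes> (g \<otimes> b \<otimes> inv g) = g \<otimes> (a \<otimes> b) \<otimes> inv g"
    if "a \<in> carrier G" "b \<in> carrier G" for a b
    using that assms(1) by (simp add: m_assoc) (simp flip: m_assoc)
  then show ?thesis using assms by simp
qed

text \<open>A commuting n-tuple fixed by g becomes a commuting (n+1)-tuple when g is put in front,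
  and every commuting (n+1)-tuple arises once in this way.\<close>

lemma beta_burnside:
  assumes "finite (carrier G)"
  shows "beta G n * Coset.order G = card (comm_lists commute (carrier G) (Suc n))"
proof -
  have "beta G n * Coset.order G =
      (\<Sum>g\<in>carrier G. card {xs \<in> comm_lists commute (carrier G) n. \<forall>x\<in>set xs. commute g x})"
    unfolding beta_def commuting_tuples_eq using assms finite_comm_lists[OF assms]
    by (rule conj_tuple_burnside)
      (auto simp: comm_lists_def conj_tuple_def subset_iff intro!: commute_conj)
  also have "\<dots> = (\<Sum>g\<in>carrier G. card (comm_lists commute {x \<in> carrier G. commute g x} n))"
    by (intro sum.cong HOL.refl arg_cong[where f = card]) (auto simp: comm_lists_def)
  finally show ?thesis using assms by (subst card_comm_lists_Suc) auto
qed

end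

section \<open>Isoclinism\<close>

context group
begin

lemma center_subgroup: "subgroup (center G) G"
proof (rule subgroupI)
  fix a b assume ab: "a \<in> center G" "b \<in> center G"
  then have c: "a \<in> carrier G" "b \<in> carrier G" by (auto simp: center_def)
  have "g \<otimes> (a \<otimes> b) = a \<otimes> b \<otimes> g" if "g \<in> carrier G" for g
    using ab c that unfolding center_def by (metis (mono_tags, lifting) m_assoc mem_Collect_eq)
  then show "a \<otimes> b \<in> center G" using c by (simp add: center_def)
  have "g \<otimes> inv a = inv a \<otimes> g" if "g \<in> carrier G" for g
  proof -
    have "a \<otimes> g = g \<otimes> a" using ab that by (simp add: center_def)
    then show ?thesis
      using c that by (metis inv_closed inv_solve_left inv_solve_right m_assoc m_closed)
  qed
  then show "inv a \<in> center G" using c by (simp add: center_def)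
qed (use one_closed in \<open>auto simp: center_def\<close>)

lemma center_normal: "center G \<lhd> G"
proof (rule normal_invI[OF center_subgroup])
  fix x h assume "x \<in> carrier G" "h \<in> center G"
  then have "x \<otimes> h \<otimes> inv x = h"
    by (simp add: center_def inv_solve_right')
  then show "x \<otimes> h \<otimes> inv x \<in> center G" using \<open>h \<in> center G\<close> by simp
qed

lemma commutator_closed:
  "x \<in> carrier G \<Longrightarrow> y \<in> carrier G \<Longrightarrow> commutator G x y \<in> carrier G"
  by (simp add: commutator_def)

lemma commutator_eq_one_iff:
  assumes "x \<in> carrier G" "y \<in> carrier G"
  shows "commutator G x y = \<one> \<longleftrightarrow> commute x y"
proof -
  have "commutator G x y = inv (y \<otimes> x) \<otimes> (x \<otimes> y)"
    using assms by (simp add: commutator_def inv_mult_group m_assoc)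
  then show ?thesis
    using assms by (metis inv_closed inv_equality inv_inv l_inv m_closed)
qed

lemma commutator_in_derived:
  assumes "x \<in> carrier G" "y \<in> carrier G"
  shows "commutator G x y \<in> derived G (carrier G)"
proof -
  have "commutator G x y = inv x \<otimes> inv y \<otimes> inv (inv x) \<otimes> inv (inv y)"
    using assms by (simp add: commutator_def)
  then have "commutator G x y \<in> derived_set G (carrier G)" using assms by blast
  then show ?thesis unfolding derived_def by (rule generate.incl)
qed

text \<open>A set closed under multiplication by Z is a disjoint union of cosets of Z, all of the
  same size.\<close>

lemma card_saturated:
  assumes "finite (carrier G)" "subgroup Z G" "S \<subseteq> carrier G"
    and sat: "\<And>z s. z \<in> Z \<Longrightarrow> s \<in> S \<Longrightarrow> z \<otimes> s \<in> S"
  shows "card S = card ((#>) Z ` S) * card Z"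
proof -
  have sub: "Z \<subseteq> carrier G" using assms(2) by (rule subgroup.subset)
  have U: "\<Union>((#>) Z ` S) = S"
  proof
    show "\<Union>((#>) Z ` S) \<subseteq> S" using sat by (auto simp: r_coset_def)
    show "S \<subseteq> \<Union>((#>) Z ` S)" using rcos_self[OF _ assms(2)] assms(3) by blast
  qed
  have cosets: "(#>) Z ` S \<subseteq> rcosets Z" using assms(3) sub rcosetsI by blast
  have "card Z * card ((#>) Z ` S) = card (\<Union>((#>) Z ` S))"
  proof (rule card_partition)
    show "finite ((#>) Z ` S)" "finite (\<Union>((#>) Z ` S))"
      using assms(1,3) finite_subset unfolding U by auto
    fix c assume "c \<in> (#>) Z ` S"
    then show "card c = card Z" using card_rcosets_equal[OF _ sub] cosets by auto
  next
    fix c d assume "c \<in> (#>) Z ` S" "d \<in> (#>) Z ` S" "c \<noteq> d"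
    then show "c \<inter> d = {}"
      using rcos_disjoint[OF assms(2)] cosets
      by (metis disjnt_def pairwiseD subsetD)
  qed
  then show ?thesis unfolding U by (simp add: mult.commute)
qed

end

text \<open>The function f picks a representative of \<theta>(g Z(G)) for each g. It respects
  commutation because \<phi>([x, y]) = [f x, f y] and the isomorphism \<phi> sends only 1 to 1.
  Sizes of preimages follow by counting cosets of the two centres, which \<theta> matches
  bijectively.\<close>

lemma isoclinic_transversal:
  fixes G :: "('a, 'b) monoid_scheme" and H :: "('c, 'd) monoid_scheme"
  assumes "group G" "group H" "isoclinic G H" "finite (carrier G)" "finite (carrier H)"
  obtains f where "f \<in> carrier G \<rightarrow> carrier H"
    and "\<And>x y. x \<in> carrier G \<Longrightarrow> y \<in> carrier G \<Longrightarrow>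
      x \<otimes>\<^bsub>G\<^esub> y = y \<otimes>\<^bsub>G\<^esub> x \<longleftrightarrow> f x \<otimes>\<^bsub>H\<^esub> f y = f y \<otimes>\<^bsub>H\<^esub> f x"
    and "\<And>S. S \<subseteq> carrier H \<Longrightarrow> (\<And>z s. z \<in> center H \<Longrightarrow> s \<in> S \<Longrightarrow> z \<otimes>\<^bsub>H\<^esub> s \<in> S) \<Longrightarrow>
      card {g \<in> carrier G. f g \<in> S} * card (center H) = card S * card (center G)"
proof -
  interpret G: group G by fact
  interpret H: group H by fact
  interpret ZG: normal "center G" G by (rule G.center_normal)
  interpret ZH: normal "center H" H by (rule H.center_normal)
  obtain \<theta> \<phi> where \<theta>: "\<theta> \<in> iso (G Mod center G) (H Mod center H)"
    and \<phi>: "\<phi> \<in> iso (derived_group G) (derived_group H)"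
    and compat: "\<And>g1 g2 h1 h2. \<lbrakk>g1 \<in> carrier G; g2 \<in> carrier G; h1 \<in> carrier H; h2 \<in> carrier H;
      \<theta> (center G #>\<^bsub>G\<^esub> g1) = center H #>\<^bsub>H\<^esub> h1; \<theta> (center G #>\<^bsub>G\<^esub> g2) = center H #>\<^bsub>H\<^esub> h2\<rbrakk>
      \<Longrightarrow> \<phi> (commutator G g1 g2) = commutator H h1 h2"
    using assms(3) unfolding isoclinic_def by metis
  have \<theta>_bij: "bij_betw \<theta> ((#>\<^bsub>G\<^esub>) (center G) ` carrier G) ((#>\<^bsub>H\<^esub>) (center H) ` carrier H)"
    using \<theta> by (simp add: iso_def carrier_FactGroup)
  then have "\<forall>g\<in>carrier G. \<exists>h\<in>carrier H. \<theta> (center G #>\<^bsub>G\<^esub> g) = center H #>\<^bsub>H\<^esub> h"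
    by (metis (no_types, lifting) bij_betw_apply imageE imageI)
  then obtain f where f: "\<And>g. g \<in> carrier G \<Longrightarrow> f g \<in> carrier H"
    and \<theta>f: "\<And>g. g \<in> carrier G \<Longrightarrow> \<theta> (center G #>\<^bsub>G\<^esub> g) = center H #>\<^bsub>H\<^esub> f g"
    by metis
  have dG: "group (derived_group G)" and dH: "group (derived_group H)"
    unfolding derived_group_def
    by (simp_all add: G.derived_is_subgroup H.derived_is_subgroup G.subgroup_imp_group H.subgroup_imp_group)
  have \<phi>_one: "\<phi> x = \<one>\<^bsub>H\<^esub> \<longleftrightarrow> x = \<one>\<^bsub>G\<^esub>" if "x \<in> derived G (carrier G)" for x
  proof -
    have "\<phi> \<one>\<^bsub>G\<^esub> = \<one>\<^bsub>H\<^esub>"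
      using hom_one[OF iso_imp_homomorphism[OF \<phi>] dG dH] by (simp add: derived_group_def)
    moreover have "inj_on \<phi> (derived G (carrier G))"
      using \<phi> by (simp add: iso_def derived_group_def bij_betw_def)
    moreover have "\<one>\<^bsub>G\<^esub> \<in> derived G (carrier G)"
      using G.derived_is_subgroup[OF subset_refl] by (rule subgroup.one_closed)
    ultimately show ?thesis using that by (metis inj_onD)
  qed
  show ?thesis
  proof
    show "f \<in> carrier G \<rightarrow> carrier H" using f by simp
    fix x y assume xy: "x \<in> carrier G" "y \<in> carrier G"
    then have "\<phi> (commutator G x y) = commutator H (f x) (f y)"
      by (intro compat f \<theta>f)
    then show "x \<otimes>\<^bsub>G\<^esub> y = y \<otimes>\<^bsub>G\<^esub> x \<longleftrightarrow> f x \<otimes>\<^bsub>H\<^esub> f y = f y \<otimes>\<^bsub>H\<^esub> f x"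
      using xy f by (metis G.commutator_eq_one_iff G.commutator_in_derived H.commutator_eq_one_iff \<phi>_one)
  next
    fix S assume S: "S \<subseteq> carrier H"
      and sat: "\<And>z s. z \<in> center H \<Longrightarrow> s \<in> S \<Longrightarrow> z \<otimes>\<^bsub>H\<^esub> s \<in> S"
    define T where "T = {g \<in> carrier G. f g \<in> S}"
    have in_S: "h \<in> S" if "center H #>\<^bsub>H\<^esub> h = center H #>\<^bsub>H\<^esub> s" "s \<in> S" "h \<in> carrier H" for h s
    proof -
      have "h \<in> center H #>\<^bsub>H\<^esub> s"
        using H.rcos_self[OF that(3) H.center_subgroup] that(1) by simp
      then show ?thesis using sat[OF _ that(2)] by (auto simp: r_coset_def)
    qed
    \<comment> \<open>The coset of \<open>f g\<close> depends only on the coset of g, so T is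
      saturated although f need not respect products.\<close>
    have "z \<otimes>\<^bsub>G\<^esub> g \<in> T" if "z \<in> center G" "g \<in> T" for z g
    proof -
      have c: "z \<in> carrier G" "g \<in> carrier G" "f g \<in> S"
        using that ZG.mem_carrier by (auto simp: T_def)
      have "center G #>\<^bsub>G\<^esub> (z \<otimes>\<^bsub>G\<^esub> g) = center G #>\<^bsub>G\<^esub> g"
        using c G.coset_mult_assoc[OF ZG.subset c(1,2)] ZG.rcos_const[OF _ that(1)]
        by (simp add: G.is_group)
      then have "center H #>\<^bsub>H\<^esub> f (z \<otimes>\<^bsub>G\<^esub> g) = center H #>\<^bsub>H\<^esub> f g"
        using \<theta>f c by (metis G.m_closed)
      then show ?thesis using in_S[OF _ c(3)] c f by (simp add: T_def)
    qed
    then have cT: "card T = card ((#>\<^bsub>G\<^esub>) (center G) ` T) * card (center G)"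
      by (intro G.card_saturated assms G.center_subgroup) (auto simp: T_def)
    have cS: "card S = card ((#>\<^bsub>H\<^esub>) (center H) ` S) * card (center H)"
      using S sat by (intro H.card_saturated assms H.center_subgroup) auto
    have "bij_betw \<theta> ((#>\<^bsub>G\<^esub>) (center G) ` T) ((#>\<^bsub>H\<^esub>) (center H) ` S)"
    proof (rule bij_betw_imageI)
      show "inj_on \<theta> ((#>\<^bsub>G\<^esub>) (center G) ` T)"
        using \<theta>_bij by (rule bij_betw_imp_inj_on[THEN inj_on_subset]) (auto simp: T_def)
      show "\<theta> ` (#>\<^bsub>G\<^esub>) (center G) ` T = (#>\<^bsub>H\<^esub>) (center H) ` S"
      proof
        show "\<theta> ` (#>\<^bsub>G\<^esub>) (center G) ` T \<subseteq> (#>\<^bsub>H\<^esub>) (center H) ` S"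
          by (auto simp: T_def \<theta>f)
        show "(#>\<^bsub>H\<^esub>) (center H) ` S \<subseteq> \<theta> ` (#>\<^bsub>G\<^esub>) (center G) ` T"
        proof
          fix C assume "C \<in> (#>\<^bsub>H\<^esub>) (center H) ` S"
          then obtain s where s: "s \<in> S" "C = center H #>\<^bsub>H\<^esub> s" by blast
          then have "C \<in> (#>\<^bsub>H\<^esub>) (center H) ` carrier H" using S by blast
          then obtain g where g: "g \<in> carrier G" "C = \<theta> (center G #>\<^bsub>G\<^esub> g)"
            using bij_betw_imp_surj_on[OF \<theta>_bij] by blast
          then have "f g \<in> S" using in_S[OF _ s(1)] s(2) \<theta>f f by metis
          then show "C \<in> \<theta> ` (#>\<^bsub>G\<^esub>) (center G) ` T" using g by (auto simp: T_def)
        qed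
      qed
    qed
    then show "card {g \<in> carrier G. f g \<in> S} * card (center H) = card S * card (center G)"
      using cT cS bij_betw_same_card unfolding T_def[symmetric] by fastforce
  qed
qed

section \<open>Transport of isoclinism along isomorphisms, and bounds on the rank\<close>

lemma image_center_iso:
  assumes "group H" "group K" "f \<in> iso H K"
  shows "f ` center H = center K"
proof -
  interpret group_hom H K f
    using assms by (simp add: group_hom_def group_hom_axioms_def iso_imp_homomorphism)
  have inj: "inj_on f (carrier H)" and surj: "f ` carrier H = carrier K"
    using assms(3) by (auto simp: iso_def bij_betw_def)
  have "f z \<in> center K \<longleftrightarrow> z \<in> center H" if z: "z \<in> carrier H" for z
  proof -
    have "f z \<in> center K \<longleftrightarrow> (\<forall>g\<in>carrier H. f (g \<otimes>\<^bsub>H\<^esub> z) = f (z \<otimes>\<^bsub>H\<^esub> g))"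
      using z by (simp add: center_def flip: surj)
    also have "\<dots> \<longleftrightarrow> (\<forall>g\<in>carrier H. g \<otimes>\<^bsub>H\<^esub> z = z \<otimes>\<^bsub>H\<^esub> g)"
      using z by (intro ball_cong refl inj_on_eq_iff[OF inj]) auto
    finally show ?thesis using z by (simp add: center_def)
  qed
  moreover have "center H \<subseteq> carrier H" "center K \<subseteq> f ` carrier H"
    unfolding surj by (auto simp: center_def)
  ultimately show ?thesis by blast
qed

text \<open>Needed because the competitors in \<open>isoclinism_rank\<close> have carrier in
  \<open>nat\<close>, while the presented group consists of sets of words. On central quotients f
  acts by taking images of cosets, on derived subgroups by restriction.\<close>

lemma isoclinic_iso_trans:
  assumes "group G" "group H" "group K" "isoclinic G H" and f: "f \<in> iso H K"
  shows "isoclinic G K"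
proof -
  interpret G: group G by fact
  interpret H: group H by fact
  interpret K: group K by fact
  interpret ZH: normal "center H" H by (rule H.center_normal)
  interpret ZK: normal "center K" K by (rule K.center_normal)
  interpret group_hom H K f
    using f by (simp add: group_hom_def group_hom_axioms_def iso_imp_homomorphism assms)
  have inj: "inj_on f (carrier H)" and surj: "f ` carrier H = carrier K"
    using f by (auto simp: iso_def bij_betw_def)
  note fZ = image_center_iso[OF assms(2,3) f]
  have f_coset: "f ` (center H #>\<^bsub>H\<^esub> h) = center K #>\<^bsub>K\<^esub> f h" if "h \<in> carrier H" for h
    using coset_hom(2)[OF homh ZH.subset that] by (simp add: fZ)
  obtain \<theta> \<phi> where \<theta>: "\<theta> \<in> iso (G Mod center G) (H Mod center H)"
    and \<phi>: "\<phi> \<in> iso (derived_group G) (derived_group H)"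
    and compat: "\<And>g1 g2 h1 h2. \<lbrakk>g1 \<in> carrier G; g2 \<in> carrier G; h1 \<in> carrier H; h2 \<in> carrier H;
      \<theta> (center G #>\<^bsub>G\<^esub> g1) = center H #>\<^bsub>H\<^esub> h1; \<theta> (center G #>\<^bsub>G\<^esub> g2) = center H #>\<^bsub>H\<^esub> h2\<rbrakk>
      \<Longrightarrow> \<phi> (commutator G g1 g2) = commutator H h1 h2"
    using assms(4) unfolding isoclinic_def by metis
  have cosets_sub: "C \<subseteq> carrier H" if "C \<in> carrier (H Mod center H)" for C
    using that ZH.rcosets_carrier[OF H.group_axioms] by (auto simp: FactGroup_def)
  have inj_img: "inj_on ((`) f) (carrier (H Mod center H))"
    using cosets_sub inj by (auto intro!: inj_onI simp: inj_on_image_eq_iff)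
  have "(`) f \<in> iso (H Mod center H) (K Mod center K)"
  proof -
    have "(`) f \<in> hom (H Mod center H) (K Mod center K)"
    proof (rule homI)
      show "f ` C \<in> carrier (K Mod center K)" if "C \<in> carrier (H Mod center H)" for C
        using that f_coset by (auto simp: carrier_FactGroup)
    qed (use cosets_sub in \<open>simp add: set_mult_hom[OF homh]\<close>)
    moreover have "(`) f ` carrier (H Mod center H) = carrier (K Mod center K)"
      unfolding carrier_FactGroup image_image surj[symmetric]
      by (rule image_cong) (use f_coset in auto)
    ultimately show ?thesis using inj_img by (simp add: iso_def bij_betw_def)
  qed
  from iso_set_trans[OF \<theta> this]
  have 1: "(`) f \<circ> \<theta> \<in> iso (G Mod center G) (K Mod center K)" .
  have dH: "derived H (carrier H) \<subseteq> carrier H" by (rule H.derived_in_carrier) simp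
  have "f \<in> iso (derived_group H) (derived_group K)"
  proof -
    have img: "f ` derived H (carrier H) = derived K (carrier K)"
      using derived_img[of "carrier H"] surj by simp
    then have "f \<in> hom (derived_group H) (derived_group K)"
      using dH by (intro homI) (auto simp: derived_group_def subset_iff)
    then show ?thesis
      using img inj_on_subset[OF inj dH] by (simp add: iso_def bij_betw_def derived_group_def)
  qed
  from iso_set_trans[OF \<phi> this]
  have 2: "f \<circ> \<phi> \<in> iso (derived_group G) (derived_group K)" .
  show ?thesis unfolding isoclinic_def
  proof (intro bexI[OF _ 1] bexI[OF _ 2] ballI impI)
    fix g1 g2 k1 k2
    assume g: "g1 \<in> carrier G" "g2 \<in> carrier G" and k: "k1 \<in> carrier K" "k2 \<in> carrier K"
      and eq: "((`) f \<circ> \<theta>) (center G #>\<^bsub>G\<^esub> g1) = center K #>\<^bsub>K\<^esub> k1"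
        "((`) f \<circ> \<theta>) (center G #>\<^bsub>G\<^esub> g2) = center K #>\<^bsub>K\<^esub> k2"
    obtain h1 h2 where h: "h1 \<in> carrier H" "h2 \<in> carrier H" "k1 = f h1" "k2 = f h2"
      using k surj by blast
    \<comment> \<open>Taking images under f is injective on cosets, so the matching condition in K
      pulls back to the one in H.\<close>
    have *: "\<theta> (center G #>\<^bsub>G\<^esub> g) = center H #>\<^bsub>H\<^esub> h"
      if "((`) f \<circ> \<theta>) (center G #>\<^bsub>G\<^esub> g) = center K #>\<^bsub>K\<^esub> f h"
        "g \<in> carrier G" "h \<in> carrier H" for g h
    proof (rule inj_onD[OF inj_img])
      have "center G #>\<^bsub>G\<^esub> g \<in> carrier (G Mod center G)"
        using that by (auto simp: carrier_FactGroup)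
      then show "f ` \<theta> (center G #>\<^bsub>G\<^esub> g) = f ` (center H #>\<^bsub>H\<^esub> h)"
        "\<theta> (center G #>\<^bsub>G\<^esub> g) \<in> carrier (H Mod center H)"
        using that \<theta> by (auto simp: f_coset iso_def dest: hom_closed bij_betw_apply)
    qed (use that in \<open>auto simp: carrier_FactGroup\<close>)
    have "\<phi> (commutator G g1 g2) = commutator H h1 h2"
      using g h eq by (intro compat *) auto
    moreover have "f (commutator H h1 h2) = commutator K k1 k2"
      using h by (simp add: commutator_def)
    moreover have "commutator G g1 g2 \<in> carrier (derived_group G)"
      using G.commutator_in_derived g by (simp add: derived_group_def)
    ultimately show "(f \<circ> \<phi>) (commutator G g1 g2) = commutator K k1 k2"
      by simp
  qed
qed

lemma ex_nat_group_iso: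
  assumes "group H" "finite (carrier H)"
  obtains K :: "nat monoid" and f where "group K" "f \<in> iso H K"
proof -
  interpret H: group H by fact
  obtain f :: "_ \<Rightarrow> nat" where f: "inj_on f (carrier H)"
    using finite_imp_inj_to_nat_seg[OF assms(2)] by blast
  define g where "g = the_inv_into (carrier H) f"
  have g: "g (f x) = x" if "x \<in> carrier H" for x
    using that f by (simp add: g_def the_inv_into_f_f)
  define K :: "nat monoid" where
    "K = \<lparr>carrier = f ` carrier H, monoid.mult = (\<lambda>x y. f (g x \<otimes>\<^bsub>H\<^esub> g y)), one = f \<one>\<^bsub>H\<^esub>\<rparr>"
  have "group K"
  proof (rule groupI)
    fix x assume "x \<in> carrier K"
    then obtain a where a: "a \<in> carrier H" "x = f a" by (auto simp: K_def)
    then show "\<exists>y\<in>carrier K. y \<otimes>\<^bsub>K\<^esub> x = \<one>\<^bsub>K\<^esub>"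
      by (intro bexI[of _ "f (inv\<^bsub>H\<^esub> a)"]) (auto simp: K_def g)
  qed (auto simp: K_def g H.m_assoc)
  moreover have "f \<in> iso H K"
    using f by (auto simp: iso_def hom_def bij_betw_def K_def g)
  ultimately show ?thesis using that by blast
qed

text \<open>Lets a competitor of any type bound the rank, by replacing it with an isomorphic copy on
  \<open>nat\<close>.\<close>

lemma isoclinism_rank_le:
  assumes "group G" "group H" "finite (carrier H)" "Coset.order H = p ^ r" "isoclinic G H"
  shows "isoclinism_rank p G \<le> r"
proof -
  obtain K :: "nat monoid" and f where K: "group K" "f \<in> iso H K"
    using ex_nat_group_iso[OF assms(2,3)] .
  then have "isoclinic G K" using isoclinic_iso_trans assms by blast
  moreover have "Coset.order K = p ^ r"
    using K(2) assms(4) bij_betw_same_card by (fastforce simp: iso_def Coset.order_def)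
  ultimately show ?thesis unfolding isoclinism_rank_def using K(1) by (intro Least_le) blast
qed

section \<open>Commutators and cyclic extensions\<close>

context group
begin

lemma conj_eq_mult_commutator:
  assumes "s \<in> carrier G" "x \<in> carrier G"
  shows "inv x \<otimes> s \<otimes> x = s \<otimes> commutator G s x"
  using assms by (simp add: commutator_def flip: m_assoc)

lemma inv_commutator:
  assumes "x \<in> carrier G" "y \<in> carrier G"
  shows "inv (commutator G x y) = commutator G y x"
  using assms by (simp add: commutator_def inv_mult_group m_assoc)

lemma commutator_self: "x \<in> carrier G \<Longrightarrow> commutator G x x = \<one>"
  by (simp add: commutator_eq_one_iff)

lemma commutator_mult_right:
  assumes "x \<in> carrier G" "y \<in> carrier G" "z \<in> carrier G"
  shows "commutator G x (y \<otimes> z) = commutator G x z \<otimes> (inv z \<otimes> commutator G x y \<otimes> z)"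
proof -
  have "z \<otimes> (inv z \<otimes> u) = u" if "u \<in> carrier G" for u
    using that assms by (simp flip: m_assoc)
  moreover have "x \<otimes> (inv x \<otimes> u) = u" if "u \<in> carrier G" for u
    using that assms by (simp flip: m_assoc)
  ultimately show ?thesis
    using assms by (simp add: commutator_def inv_mult_group m_assoc)
qed

lemma commutator_inv_right:
  assumes "x \<in> carrier G" "y \<in> carrier G"
  shows "commutator G x (inv y) = y \<otimes> inv (commutator G x y) \<otimes> inv y"
proof -
  have "y \<otimes> (inv y \<otimes> u) = u" if "u \<in> carrier G" for u
    using that assms by (simp flip: m_assoc)
  then show ?thesis
    using assms by (simp add: commutator_def inv_mult_group m_assoc)
qed

text \<open>This set is the preimage of the centralizer of yK in the quotient by K. Closure comes
  from [y, h h'] = [y, h'] [y, h]^{h'} and the normality of K.\<close>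

lemma subgroup_commutator_right:
  assumes "K \<lhd> G" "y \<in> carrier G"
  shows "subgroup {h \<in> carrier G. commutator G y h \<in> K} G"
proof -
  interpret K: normal K G by fact
  show ?thesis
  proof (rule subgroupI)
    show "{h \<in> carrier G. commutator G y h \<in> K} \<noteq> {}"
      using assms(2) by (auto intro!: exI[of _ \<one>] simp: commutator_def)
  qed (auto simp: assms(2) commutator_mult_right commutator_inv_right K.inv_op_closed1
      K.inv_op_closed2)
qed

lemma subgroup_commutator_left:
  assumes "K \<lhd> G" "h \<in> carrier G"
  shows "subgroup {y \<in> carrier G. commutator G y h \<in> K} G"
proof -
  interpret K: normal K G by fact
  have "commutator G y h \<in> K \<longleftrightarrow> commutator G h y \<in> K" if "y \<in> carrier G" for y
    using that assms(2) K.m_inv_closed by (metis inv_commutator)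
  then have "{y \<in> carrier G. commutator G y h \<in> K} = {y \<in> carrier G. commutator G h y \<in> K}"
    by blast
  then show ?thesis using subgroup_commutator_right[OF assms] by simp
qed

text \<open>Commutators modulo K need checking on generators only: the second argument is extended
  from T to its span for fixed s, then the first from S to its span.\<close>

lemma commutator_generate:
  assumes "K \<lhd> G" "S \<subseteq> carrier G" "T \<subseteq> carrier G"
    and "\<And>s t. s \<in> S \<Longrightarrow> t \<in> T \<Longrightarrow> commutator G s t \<in> K"
    and "x \<in> generate G S" "y \<in> generate G T"
  shows "commutator G x y \<in> K"
proof -
  have "generate G T \<subseteq> {h \<in> carrier G. commutator G s h \<in> K}" if "s \<in> S" for s
    using assms that by (intro generate_subgroup_incl subgroup_commutator_right) auto
  moreover have "y \<in> carrier G" using generate_in_carrier assms by blast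
  ultimately have "generate G S \<subseteq> {h \<in> carrier G. commutator G h y \<in> K}"
    using assms by (intro generate_subgroup_incl subgroup_commutator_left) auto
  then show ?thesis using assms(5) by blast
qed

lemma commute_generate:
  assumes "S \<subseteq> carrier G" "T \<subseteq> carrier G"
    and "\<And>s t. s \<in> S \<Longrightarrow> t \<in> T \<Longrightarrow> commutator G s t = \<one>"
    and "x \<in> generate G S" "y \<in> generate G T"
  shows "commute x y"
proof -
  have "commutator G x y \<in> {\<one>}"
    by (rule commutator_generate[OF one_is_normal assms(1,2) _ assms(4,5)]) (simp add: assms(3))
  then show ?thesis
    using assms(1,2,4,5) generate_in_carrier by (simp add: commutator_eq_one_iff)
qed

lemma subgroup_centralizer:
  assumes "g \<in> carrier G"
  shows "subgroup {y \<in> carrier G. commute g y} G"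
  using subgroup_commutator_right[OF one_is_normal assms] assms
  by (simp add: commutator_eq_one_iff cong: conj_cong)

lemma conj_generate_closed:
  assumes "S \<subseteq> carrier G" "x \<in> carrier G" "\<And>s. s \<in> S \<Longrightarrow> commutator G s x \<in> generate G S"
    and "k \<in> generate G S"
  shows "inv x \<otimes> k \<otimes> x \<in> generate G S"
  using assms(4)
proof induction
  case (incl h)
  then show ?case
    using assms generate.eng[OF generate.incl[OF incl] assms(3)[OF incl]]
    by (subst conj_eq_mult_commutator) auto
next
  case (inv h)
  then have "inv x \<otimes> h \<otimes> x \<in> generate G S" "h \<in> carrier G"
    using assms generate.eng[OF generate.incl[OF inv] assms(3)[OF inv]]
    by (auto simp: conj_eq_mult_commutator)
  moreover from this have "inv x \<otimes> inv h \<otimes> x = inv (inv x \<otimes> h \<otimes> x)"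
    using assms(2) by (simp add: inv_mult_group m_assoc)
  ultimately show ?case using generate_m_inv_closed[OF assms(1)] by simp
next
  case (eng h1 h2)
  then have h: "h1 \<in> carrier G" "h2 \<in> carrier G" using assms(1) generate_in_carrier by auto
  have "x \<otimes> (inv x \<otimes> u) = u" if "u \<in> carrier G" for u
    using that assms(2) by (simp flip: m_assoc)
  then have "inv x \<otimes> (h1 \<otimes> h2) \<otimes> x = (inv x \<otimes> h1 \<otimes> x) \<otimes> (inv x \<otimes> h2 \<otimes> x)"
    using h assms(2) by (simp add: m_assoc)
  then show ?case using generate.eng[OF eng(3,4)] by simp
qed (use assms in \<open>simp add: generate.one\<close>)

text \<open>The commutator hypothesis says only that conjugation by a generator t maps the span K of
  S into itself. Invariance under the inverse of t comes from finiteness.\<close>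

lemma normal_generate_commutator:
  assumes "S \<subseteq> carrier G" "T \<subseteq> carrier G" "generate G T = carrier G" "finite (generate G S)"
    and comm: "\<And>s t. s \<in> S \<Longrightarrow> t \<in> T \<Longrightarrow> commutator G s t \<in> generate G S"
  shows "generate G S \<lhd> G"
proof -
  let ?K = "generate G S"
  have sub: "subgroup ?K G" using assms(1) by (rule generate_is_subgroup)
  then have K: "?K \<subseteq> carrier G" by (rule subgroup.subset)
  have "\<forall>k\<in>?K. inv x \<otimes> k \<otimes> x \<in> ?K" if "x \<in> generate G T" for x
    using that
  proof induction
    case (incl t)
    then show ?case using conj_generate_closed[OF assms(1) _ comm] assms(2) by blast
  next
    case (inv t)
    then have t: "t \<in> carrier G" using assms(2) by blast
    \<comment> \<open>An injective self-map of a finite set is onto, so each k is the conjugate of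
      some element of K, and conjugating back stays in K.\<close>
    have "(\<lambda>k. inv t \<otimes> k \<otimes> t) ` ?K = ?K"
    proof (rule endo_inj_surj[OF assms(4)])
      show "(\<lambda>k. inv t \<otimes> k \<otimes> t) ` ?K \<subseteq> ?K"
        using conj_generate_closed[OF assms(1) t comm] inv by blast
      show "inj_on (\<lambda>k. inv t \<otimes> k \<otimes> t) ?K"
        using K t by (auto intro!: inj_onI simp: subset_iff)
    qed
    moreover have "t \<otimes> (inv t \<otimes> k \<otimes> t) \<otimes> inv t = k" if "k \<in> carrier G" for k
      using that t by (simp add: m_assoc) (simp flip: m_assoc)
    ultimately show ?case using K t by (smt (verit) imageE inv_inv subsetD)
  next
    case (eng x y)
    then have "x \<in> carrier G" "y \<in> carrier G" using assms(3) by auto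
    then have "inv (x \<otimes> y) \<otimes> k \<otimes> (x \<otimes> y) = inv y \<otimes> (inv x \<otimes> k \<otimes> x) \<otimes> y"
      if "k \<in> ?K" for k
      using that K by (auto simp: inv_mult_group m_assoc subset_iff)
    then show ?case using eng by simp
  qed (use K in auto)
  then have "x \<otimes> k \<otimes> inv x \<in> ?K" if "x \<in> carrier G" "k \<in> ?K" for x k
    using that assms(3) by (metis inv_closed inv_inv)
  then show ?thesis by (intro normal_invI[OF sub])
qed

section \<open>Cyclic extensions by an element whose p-th power lies in the subgroup\<close>

lemma conj_pow_closed:
  assumes "subgroup K G" "x \<in> carrier G" "\<And>k. k \<in> K \<Longrightarrow> inv x \<otimes> k \<otimes> x \<in> K" "k \<in> K"
  shows "\<exists>k'\<in>K. k \<otimes> x [^] (n::nat) = x [^] n \<otimes> k'"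
proof (induction n)
  case 0
  then show ?case using assms subgroup.mem_carrier by fastforce
next
  case (Suc n)
  then obtain k' where k': "k' \<in> K" "k \<otimes> x [^] n = x [^] n \<otimes> k'" by blast
  have c: "k \<in> carrier G" "k' \<in> carrier G" using assms k' subgroup.mem_carrier by metis+
  have "k \<otimes> x [^] Suc n = x [^] n \<otimes> k' \<otimes> x"
    using k' c assms(2) by (simp flip: m_assoc)
  also have "\<dots> = x [^] Suc n \<otimes> (inv x \<otimes> k' \<otimes> x)"
  proof -
    have "x \<otimes> (inv x \<otimes> u) = u" if "u \<in> carrier G" for u
      using that assms(2) by (simp flip: m_assoc)
    then show ?thesis using c assms(2) by (simp add: m_assoc)
  qed
  finally show ?case using assms(3)[OF k'(1)] by blast
qed

lemma pow_mem_coprime: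
  assumes "subgroup K G" "x \<in> carrier G" "x [^] (m::nat) \<in> K" "x [^] (n::nat) \<in> K" "coprime m n"
  shows "x \<in> K"
proof -
  obtain u v where "u * int m + v * int n = 1"
    using assms(5) bezout_int[of "int m" "int n"] by auto
  then have "x = x [^] (int m * u + int n * v)"
    using assms(2) by (simp add: mult.commute)
  also have "\<dots> = (x [^] m) [^] u \<otimes> (x [^] n) [^] v"
    using assms(2) by (simp add: int_pow_mult int_pow_pow[symmetric] int_pow_int)
  also have "\<dots> \<in> K"
    using assms(1,3,4) by (intro subgroup.m_closed subgroup_int_pow_closed)
  finally show ?thesis .
qed

text \<open>Since x conjugates K = \<open>generate G S\<close> into itself, powers of x can be
  collected on the left, and x^p in K reduces the exponent modulo p. The products x^i k with
  arbitrary i are shown to form a subgroup first.\<close>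

lemma generate_insert_normalizing:
  fixes p :: nat
  assumes "prime p" "S \<subseteq> carrier G" "x \<in> carrier G"
    and comm: "\<And>s. s \<in> S \<Longrightarrow> commutator G s x \<in> generate G S"
    and pow: "x [^] p \<in> generate G S"
  shows "generate G (insert x S) = (\<lambda>(i, k). x [^] i \<otimes> k) ` ({..<p} \<times> generate G S)"
proof -
  let ?K = "generate G S" and ?L = "{x [^] i \<otimes> k | (i::nat) k. k \<in> generate G S}"
  have sub: "subgroup ?K G" using assms(2) by (rule generate_is_subgroup)
  then have K: "k \<in> carrier G" if "k \<in> ?K" for k using that by (rule subgroup.mem_carrier)
  have conj: "inv x \<otimes> k \<otimes> x \<in> ?K" if "k \<in> ?K" for k
    using conj_generate_closed[OF assms(2,3) comm that] by blast
  have L_mult: "u \<otimes> v \<in> ?L" if uvL: "u \<in> ?L" "v \<in> ?L" for u v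
  proof -
    obtain i k j l where uv: "u = x [^] (i::nat) \<otimes> k" "v = x [^] (j::nat) \<otimes> l" "k \<in> ?K" "l \<in> ?K"
      using uvL by blast
    then obtain k' where k': "k' \<in> ?K" "k \<otimes> x [^] j = x [^] j \<otimes> k'"
      using conj_pow_closed[OF sub assms(3) conj] by blast
    have "u \<otimes> v = x [^] i \<otimes> (k \<otimes> x [^] j) \<otimes> l"
      using uv K assms(3) by (simp add: m_assoc)
    also have "\<dots> = x [^] (i + j) \<otimes> (k' \<otimes> l)"
      using uv k' K assms(3) by (simp add: m_assoc flip: nat_pow_mult)
    finally show ?thesis using subgroup.m_closed[OF sub k'(1) uv(4)] by blast
  qed
  have K_L: "k \<in> ?L" if "k \<in> ?K" for k
    using that K by (auto intro!: exI[of _ "0::nat"] exI[of _ k])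
  have pow_L: "x [^] (i::nat) \<in> ?L" for i
    using assms(3) generate.one[of G S] by (auto intro!: exI[of _ i] exI[of _ \<one>])
  \<comment> \<open>Only conjugation by x in one direction is known to preserve K, so the inverse of
    x is itself written in the collected form, with the nonnegative exponent p - 1.\<close>
  have "x [^] (p - 1) \<otimes> inv (x [^] p) = inv x"
  proof -
    have "x [^] p = x \<otimes> x [^] (p - 1)"
      using nat_pow_Suc2[OF assms(3), of "p - 1"] prime_gt_0_nat[OF assms(1)] by simp
    then show ?thesis using assms(3) by (simp add: inv_mult_group flip: m_assoc)
  qed
  then have inv_L: "inv x \<in> ?L"
    using L_mult[OF pow_L K_L[OF subgroup.m_inv_closed[OF sub pow]], of "p - 1"] by simp
  have inv_pow_L: "inv x [^] (i::nat) \<in> ?L" for i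
  proof (induction i)
    case 0
    then show ?case using K_L[OF generate.one] by simp
  next
    case (Suc i)
    then show ?case using L_mult[OF Suc inv_L] by simp
  qed
  have "subgroup ?L G"
  proof (rule subgroupI)
    show "inv u \<in> ?L" if uL: "u \<in> ?L" for u
    proof -
      obtain i k where u: "u = x [^] (i::nat) \<otimes> k" "k \<in> ?K" using uL by blast
      then have "inv u = inv k \<otimes> inv x [^] i"
        using K assms(3) by (simp add: inv_mult_group nat_pow_inv)
      then show ?thesis
        using L_mult[OF K_L[OF subgroup.m_inv_closed[OF sub u(2)]] inv_pow_L[of i]] by simp
    qed
    show "?L \<noteq> {}" using pow_L by blast
  qed (use K assms(3) L_mult in blast)+
  moreover have "insert x S \<subseteq> ?L"
  proof -
    have "x \<in> ?L" using pow_L[of 1] assms(3) by simp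
    moreover have "s \<in> ?L" if "s \<in> S" for s using K_L[OF generate.incl[OF that]] .
    ultimately show ?thesis by blast
  qed
  ultimately have "generate G (insert x S) \<subseteq> ?L" by (intro generate_subgroup_incl)
  also have "?L \<subseteq> (\<lambda>(i, k). x [^] i \<otimes> k) ` ({..<p} \<times> ?K)"
  proof
    fix u assume "u \<in> ?L"
    then obtain i k where u: "u = x [^] (i::nat) \<otimes> k" "k \<in> ?K" by blast
    have "x [^] i = x [^] (i mod p) \<otimes> (x [^] p) [^] (i div p)"
      using assms(3) by (simp add: nat_pow_mult nat_pow_pow)
    then have "u = x [^] (i mod p) \<otimes> ((x [^] p) [^] (i div p) \<otimes> k)"
      using u K assms(3) by (simp add: m_assoc)
    moreover have "(x [^] p) [^] (i div p) \<otimes> k \<in> ?K"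
      using subgroup.m_closed[OF sub subgroup_int_pow_closed[OF sub pow, of "int (i div p)"] u(2)]
      by (simp add: int_pow_int)
    moreover have "i mod p < p" using prime_gt_0_nat[OF assms(1)] by simp
    ultimately show "u \<in> (\<lambda>(i, k). x [^] i \<otimes> k) ` ({..<p} \<times> ?K)" by force
  qed
  finally have "generate G (insert x S) \<subseteq> (\<lambda>(i, k). x [^] i \<otimes> k) ` ({..<p} \<times> ?K)" .
  moreover have "x [^] (i::nat) \<otimes> k \<in> generate G (insert x S)" if "k \<in> ?K" for i k
  proof (rule generate.eng)
    have "subgroup (generate G (insert x S)) G"
      using assms by (intro generate_is_subgroup) auto
    then show "x [^] i \<in> generate G (insert x S)"
      using subgroup_int_pow_closed[OF _ generate.incl[of x "insert x S" G], of "int i"]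
      by (simp add: int_pow_int)
    show "k \<in> generate G (insert x S)" using mono_generate[OF subset_insertI] that by (rule subsetD)
  qed
  then have "(\<lambda>(i, k). x [^] i \<otimes> k) ` ({..<p} \<times> ?K) \<subseteq> generate G (insert x S)"
    by (simp add: image_subset_iff)
  ultimately show ?thesis by (rule subset_antisym)
qed

text \<open>The products x^i k with i < p are distinct: a coincidence would put x^d into K for some
  0 < d < p, and together with x^p in K and gcd(d, p) = 1 this would put x into K.\<close>

lemma card_generate_insert:
  fixes p :: nat
  assumes "prime p" "S \<subseteq> carrier G" "x \<in> carrier G"
    and "\<And>s. s \<in> S \<Longrightarrow> commutator G s x \<in> generate G S"
    and "x [^] p \<in> generate G S" and "x \<notin> generate G S"
  shows "card (generate G (insert x S)) = p * card (generate G S)"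
proof -
  let ?K = "generate G S"
  have sub: "subgroup ?K G" using assms(2) by (rule generate_is_subgroup)
  then have K: "k \<in> carrier G" if "k \<in> ?K" for k using that by (rule subgroup.mem_carrier)
  have *: False if "i < j" "j < p" "x [^] i \<otimes> k = x [^] j \<otimes> l" "k \<in> ?K" "l \<in> ?K"
    for i j :: nat and k l
  proof -
    have "x [^] i \<otimes> k = x [^] i \<otimes> (x [^] (j - i) \<otimes> l)"
      using that K assms(3) by (simp add: nat_pow_mult flip: m_assoc)
    then have "x [^] (j - i) \<otimes> l = k" using that K assms(3) by simp
    then have "x [^] (j - i) = k \<otimes> inv l"
      using that K assms(3) by (metis inv_solve_right nat_pow_closed)
    then have "x [^] (j - i) \<in> ?K"
      using that sub by (simp add: subgroup.m_closed subgroup.m_inv_closed)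
    moreover have "coprime (j - i) p"
      using that assms(1) by (metis coprime_commute less_imp_diff_less nat_dvd_not_less
          prime_imp_coprime zero_less_diff)
    ultimately show False using pow_mem_coprime[OF sub assms(3) _ assms(5)] assms(6) by blast
  qed
  have "inj_on (\<lambda>(i, k). x [^] i \<otimes> k) ({..<p} \<times> ?K)"
  proof (rule inj_onI, clarsimp)
    fix i k j l assume **: "i < p" "j < p" "k \<in> ?K" "l \<in> ?K" "x [^] i \<otimes> k = x [^] j \<otimes> l"
    then have "i = j" using *[of i j k l] *[of j i l k] by (metis nat_neq_iff)
    then show "i = j \<and> k = l" using ** K assms(3) by simp
  qed
  then show ?thesis
    using generate_insert_normalizing[OF assms(1-5)] by (simp add: card_image card_cartesian_product)
qed

lemma finite_generate_insert:
  fixes p :: nat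
  assumes "prime p" "S \<subseteq> carrier G" "x \<in> carrier G"
    and "\<And>s. s \<in> S \<Longrightarrow> commutator G s x \<in> generate G S"
    and "x [^] p \<in> generate G S" and "finite (generate G S)"
  shows "finite (generate G (insert x S))"
  using generate_insert_normalizing[OF assms(1-5)] assms(6) by simp

text \<open>Covers the possibility that the new generator is already present, as may happen when the
  presented group collapses.\<close>

lemma card_generate_insert_cases:
  fixes p :: nat
  assumes "prime p" "S \<subseteq> carrier G" "x \<in> carrier G"
    and "\<And>s. s \<in> S \<Longrightarrow> commutator G s x \<in> generate G S"
    and "x [^] p \<in> generate G S" and "\<exists>r\<le>n. card (generate G S) = p ^ r"
  shows "\<exists>r\<le>Suc n. card (generate G (insert x S)) = p ^ r"
proof (cases "x \<in> generate G S")
  case True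
  then have "generate G (insert x S) \<subseteq> generate G S"
    using assms(2) generate.incl by (intro generate_subgroup_incl generate_is_subgroup) auto
  then have "generate G (insert x S) = generate G S"
    using mono_generate[of S "insert x S"] by blast
  then show ?thesis using assms(6) le_Suc_eq by auto
next
  case False
  then show ?thesis
    using card_generate_insert[OF assms(1-5) False] assms(6) by (metis Suc_le_mono power_Suc)
qed

section \<open>Subgroups of index p and of index the square of p\<close>

lemma card_subgroup_dvd:
  assumes "subgroup M G" "subgroup L G" "M \<subseteq> L"
  shows "card M dvd card L"
proof -
  interpret L: group "G\<lparr>carrier := L\<rparr>" using assms(2) by (rule subgroup_imp_group)
  have "subgroup M (G\<lparr>carrier := L\<rparr>)" using assms by (intro subgroup_incl)
  from L.lagrange[OF this] have "card (rcosets\<^bsub>G\<lparr>carrier := L\<rparr>\<^esub> M) * card M = card L"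
    by (simp add: Coset.order_def)
  then show ?thesis by (metis dvd_triv_right)
qed

text \<open>The indices of M in L and of L in P multiply to the prime p, and the first is not 1
  because of x.\<close>

lemma prime_index_maximal:
  assumes "subgroup M G" "subgroup L G" "subgroup P G" "M \<subseteq> L" "L \<subseteq> P" "finite P"
    and "card P = p * card M" "prime p" "x \<in> L" "x \<notin> M"
  shows "L = P"
proof -
  obtain i j where i: "card L = card M * i" and j: "card P = card L * j"
    using card_subgroup_dvd assms by (metis dvdE)
  have "card M > 0"
    using assms finite_subset by (metis card_gt_0_iff emptyE subgroup.one_closed)
  then have "i * j = p" using i j assms(7) by (simp add: mult_ac)
  then have "i = 1 \<or> j = 1" using prime_product assms(8) by blast
  moreover have "i \<noteq> 1"
  proof
    assume "i = 1"
    then have "M = L" using i assms by (metis card_subset_eq finite_subset mult.right_neutral)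
    then show False using assms by blast
  qed
  ultimately show ?thesis using j assms(5,6) by (metis card_subset_eq mult.right_neutral)
qed

lemma card_strictly_between:
  assumes "subgroup M G" "subgroup L G" "subgroup P G" "M \<subset> L" "L \<subset> P" "finite P"
    and "card P = p\<^sup>2 * card M" "prime (p::nat)"
  shows "card L = p * card M"
proof -
  obtain i j where i: "card L = card M * i" and j: "card P = card L * j"
    using card_subgroup_dvd assms by (metis dvdE psubset_imp_subset)
  have "card M > 0"
    using assms finite_subset by (metis card_gt_0_iff emptyE subgroup.one_closed psubset_imp_subset)
  then have ij: "i * j = p ^ 2" using i j assms(7) by (simp add: mult_ac)
  have "i \<noteq> 1" "j \<noteq> 1"
    using i j psubset_card_mono[OF finite_subset[OF _ assms(6)] assms(4)]
      psubset_card_mono[OF assms(6,5)] assms(5) by auto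
  moreover obtain m where "m \<le> 2" "i = p ^ m"
    using divides_primepow_nat[OF assms(8), of i 2] ij by (metis dvd_triv_left)
  \<comment> \<open>Of the exponents m = 0, 1, 2 the first gives i = 1 and the last gives j = 1,
    both excluded.\<close>
  ultimately have "i = p"
    using ij assms(8) prime_gt_0_nat[OF assms(8)]
    by (cases m; cases "m - 1"; auto simp: power2_eq_square)
  then show ?thesis using i by simp
qed

text \<open>If \<open>[g, x]\<close> were in \<open>K\<close>, then in the quotient by \<open>K\<close> the centralizer of \<open>g\<close> would be everything, and then
  the centralizer of \<open>a\<close> in \<open>P\<close> would be all of \<open>P\<close>.\<close>

lemma commutator_notin:
  assumes "finite (carrier G)" "prime p" "K \<lhd> G" "subgroup Q G" "subgroup P G" "subgroup A G"
    and "Q \<subseteq> P" "card P = p * card Q" "Coset.order G = p * card A"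
    and PA: "\<And>y x. y \<in> P \<Longrightarrow> x \<in> A \<Longrightarrow> commutator G y x \<in> K"
    and Q: "\<And>y. y \<in> Q \<Longrightarrow> commutator G y a \<in> K"
    and u: "u \<in> P" "commutator G u a \<notin> K" "a \<in> carrier G"
    and g: "g \<in> P" "g \<notin> Q" "x \<in> carrier G" "x \<notin> A"
  shows "commutator G g x \<notin> K"
proof
  assume gx: "commutator G g x \<in> K"
  have sub: "P \<subseteq> carrier G" "A \<subseteq> carrier G" "Q \<subseteq> carrier G"
    using assms(4-6) subgroup.subset by auto
  have "{h \<in> carrier G. commutator G g h \<in> K} = carrier G"
  proof (rule prime_index_maximal[OF assms(6) subgroup_commutator_right[OF assms(3)] subgroup_self])
    show "card (carrier G) = p * card A" using assms(9) by (simp add: Coset.order_def)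
    show "A \<subseteq> {h \<in> carrier G. commutator G g h \<in> K}" using PA g(1) sub by blast
    show "x \<in> {h \<in> carrier G. commutator G g h \<in> K}" using gx g by blast
  qed (use assms sub in auto)
  then have ga: "commutator G g a \<in> K" using u(3) by blast
  have "P \<inter> {y \<in> carrier G. commutator G y a \<in> K} = P"
  proof (rule prime_index_maximal[OF assms(4) subgroups_Inter_pair assms(5)])
    show "subgroup {y \<in> carrier G. commutator G y a \<in> K} G"
      using subgroup_commutator_left[OF assms(3) u(3)] .
    show "Q \<subseteq> P \<inter> {y \<in> carrier G. commutator G y a \<in> K}" using Q assms(7) sub by blast
    show "g \<in> P \<inter> {y \<in> carrier G. commutator G y a \<in> K}" using ga g sub by blast
  qed (use assms sub finite_subset[OF sub(1) assms(1)] in auto)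
  then show False using u by blast
qed

text \<open>The quotient by A has order p, so p-th powers vanish in it.\<close>

lemma pow_prime_index_mem:
  assumes "A \<lhd> G" "finite (carrier G)" "Coset.order G = p * card A" "x \<in> carrier G"
  shows "x [^] p \<in> A"
proof -
  interpret A: normal A G by fact
  interpret Q: group "G Mod A" by (rule A.factorgroup_is_group)
  have "card A > 0" using A.one_closed A.subset assms(2) finite_subset by (metis card_gt_0_iff emptyE)
  then have "Coset.order (G Mod A) = p"
    using lagrange[OF A.subgroup_axioms] assms(3)
    by (simp add: Coset.order_def FactGroup_def)
  moreover have "A #> x \<in> carrier (G Mod A)" using assms(4) by (auto simp: carrier_FactGroup)
  ultimately have "(A #> x) [^]\<^bsub>G Mod A\<^esub> p = A" using Q.pow_order_eq_1 by force
  then have "A #> x [^] p = A" using A.FactGroup_pow[OF assms(4)] by simp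
  then show ?thesis using rcos_self[OF nat_pow_closed[OF assms(4)] A.subgroup_axioms] by metis
qed

end

section \<open>The structure of $\Phi_{10}$\<close>

text \<open>From the power relators only this is kept: the p-th power of each generator lies in the
  span of the later ones. In this form they are what \<open>generate_insert_normalizing\<close> asks
  for at each level of the flag.\<close>

locale phi10_relations = group G for G (structure) +
  fixes p :: nat and a a1 a2 a3 a4 :: 'a
  assumes prime: "prime p"
    and in_carrier [simp]: "a \<in> carrier G" "a1 \<in> carrier G" "a2 \<in> carrier G" "a3 \<in> carrier G"
      "a4 \<in> carrier G"
    and generate_gens: "generate G {a, a1, a2, a3, a4} = carrier G"
    and comm_a: "commutator G a1 a = a2" "commutator G a2 a = a3" "commutator G a3 a = a4"
      "commutator G a4 a = \<one>"
    and comm_12: "commutator G a1 a2 = a4"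
    and comm_trivial: "commutator G a1 a3 = \<one>" "commutator G a1 a4 = \<one>"
      "commutator G a2 a3 = \<one>" "commutator G a2 a4 = \<one>" "commutator G a3 a4 = \<one>"
    and pow: "a [^] p \<in> generate G {a1, a2, a3, a4}" "a1 [^] p \<in> generate G {a2, a3, a4}"
      "a2 [^] p \<in> generate G {a3, a4}" "a3 [^] p \<in> generate G {a4}" "a4 [^] p \<in> generate G {}"
begin

lemma comm_rev:
  "commutator G a a1 = inv a2" "commutator G a a2 = inv a3" "commutator G a a3 = inv a4"
  "commutator G a a4 = \<one>" "commutator G a2 a1 = inv a4" "commutator G a3 a1 = \<one>"
  "commutator G a4 a1 = \<one>" "commutator G a3 a2 = \<one>" "commutator G a4 a2 = \<one>"
  "commutator G a4 a3 = \<one>"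
  by (subst inv_commutator[symmetric]; simp add: comm_a comm_12 comm_trivial)+

lemmas comm = comm_a comm_12 comm_trivial comm_rev commutator_self

lemmas gen = generate.one generate.incl generate.inv

abbreviation "Z \<equiv> generate G {a4}"
abbreviation "D \<equiv> generate G {a3, a4}"
abbreviation "E \<equiv> generate G {a2, a3, a4}"
abbreviation "A \<equiv> generate G {a1, a2, a3, a4}"

lemma generate_empty: "generate G {} = {\<one>}"
  using generate_subgroup_incl[of "{}" "{\<one>}"] one_is_normal generate.one[of G "{}"]
  by (auto dest: normal_imp_subgroup)

text \<open>With \<open>a4\<close> trivial so is Z, and each of the four remaining generators
  multiplies the order by 1 or by p.\<close>

lemma order_power_if_trivial:
  assumes "a4 = \<one>"
  shows "\<exists>r\<le>4. Coset.order G = p ^ r"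
proof -
  have "Z = {\<one>}"
    using generate_subgroup_incl[of "{a4}" "{\<one>}"] one_is_normal generate.one[of G "{a4}"] assms
    by (auto dest: normal_imp_subgroup)
  then have "\<exists>r\<le>0. card Z = p ^ r" by simp
  then have "\<exists>r\<le>Suc 0. card D = p ^ r"
    by (rule card_generate_insert_cases[OF prime, rotated -1]) (auto simp: comm gen pow)
  then have "\<exists>r\<le>Suc (Suc 0). card E = p ^ r"
    by (rule card_generate_insert_cases[OF prime, rotated -1]) (auto simp: comm gen pow)
  then have "\<exists>r\<le>Suc (Suc (Suc 0)). card A = p ^ r"
    by (rule card_generate_insert_cases[OF prime, rotated -1]) (auto simp: comm gen pow)
  then have "\<exists>r\<le>Suc (Suc (Suc (Suc 0))). card (generate G {a, a1, a2, a3, a4}) = p ^ r"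
    by (rule card_generate_insert_cases[OF prime, rotated -1]) (auto simp: comm gen pow)
  then show ?thesis by (simp add: generate_gens Coset.order_def eval_nat_numeral)
qed

end

locale phi10_nontrivial = phi10_relations +
  assumes a4_neq_one: "a4 \<noteq> \<one>"
begin

lemma subgroups: "subgroup Z G" "subgroup D G" "subgroup E G" "subgroup A G"
  by (auto intro!: generate_is_subgroup)

lemma subs_carrier: "x \<in> Z \<Longrightarrow> x \<in> carrier G" "x \<in> D \<Longrightarrow> x \<in> carrier G"
  "x \<in> E \<Longrightarrow> x \<in> carrier G" "x \<in> A \<Longrightarrow> x \<in> carrier G"
  using subgroups subgroup.mem_carrier by metis+

lemma flag: "Z \<subseteq> D" "D \<subseteq> E" "E \<subseteq> A"
  by (auto intro!: mono_generate)

lemma Z_commute: "x \<in> Z \<Longrightarrow> y \<in> carrier G \<Longrightarrow> commute x y"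
  unfolding generate_gens[symmetric] by (erule commute_generate[rotated 3]) (auto simp: comm)

lemma D_A_commute: "x \<in> D \<Longrightarrow> y \<in> A \<Longrightarrow> commute x y"
  by (erule commute_generate[rotated 3]) (auto simp: comm)

lemma E_commute: "x \<in> E \<Longrightarrow> y \<in> E \<Longrightarrow> commute x y"
  by (erule commute_generate[rotated 3]) (auto simp: comm)

lemma not_commute: "\<not> commute a3 a" "\<not> commute a2 a1" "\<not> commute a1 a2"
  using a4_neq_one comm_a(3) comm_12 commutator_eq_one_iff in_carrier by metis+

text \<open>Each membership would force a commutation that a4 = [a3, a] = [a1, a2] forbids: a3 with
  a because Z is central, a2 with a1 and a3 with a because D centralizes A, a1 with a2 because E is
  abelian.\<close>

lemma notin: "a4 \<notin> generate G {}" "a3 \<notin> Z" "a2 \<notin> D" "a1 \<notin> E" "a \<notin> A"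
proof -
  show "a4 \<notin> generate G {}" using a4_neq_one by (simp add: generate_empty)
  show "a3 \<notin> Z" using Z_commute not_commute by auto
  show "a2 \<notin> D" using D_A_commute[of a2 a1] not_commute by (auto simp: gen)
  show "a1 \<notin> E" using E_commute[of a1 a2] not_commute by (auto simp: gen)
  show "a \<notin> A" using D_A_commute[of a3 a] not_commute by (auto simp: gen)
qed

lemma finite: "finite (carrier G)"
proof -
  have "finite (generate G {})" by (simp add: generate_empty)
  then have "finite Z"
    by (rule finite_generate_insert[OF prime, rotated -1]) (auto simp: comm gen pow)
  then have "finite D"
    by (rule finite_generate_insert[OF prime, rotated -1]) (auto simp: comm gen pow)
  then have "finite E"
    by (rule finite_generate_insert[OF prime, rotated -1]) (auto simp: comm gen pow)
  then have "finite A"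
    by (rule finite_generate_insert[OF prime, rotated -1]) (auto simp: comm gen pow)
  then have "finite (generate G {a, a1, a2, a3, a4})"
    by (rule finite_generate_insert[OF prime, rotated -1]) (auto simp: comm gen pow)
  then show ?thesis by (simp add: generate_gens)
qed

lemma finite_subs: "finite Z" "finite D" "finite E" "finite A"
  using finite subgroups finite_subset subgroup.subset by metis+

lemma cards: "card Z = p" "card D = p ^ 2" "card E = p ^ 3" "card A = p ^ 4" "Coset.order G = p ^ 5"
proof -
  show 1: "card Z = p"
    using card_generate_insert[OF prime, of "{}" a4] notin(1) pow
    by (simp add: generate_empty)
  have "card D = p * card Z"
    using notin by (intro card_generate_insert[OF prime]) (auto simp: comm gen pow)
  with 1 show 2: "card D = p ^ 2" by (simp add: power2_eq_square)
  have "card E = p * card D"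
    using notin by (intro card_generate_insert[OF prime]) (auto simp: comm gen pow)
  with 2 show 3: "card E = p ^ 3" by (simp flip: power_Suc)
  have "card A = p * card E"
    using notin by (intro card_generate_insert[OF prime]) (auto simp: comm gen pow)
  with 3 show 4: "card A = p ^ 4" by (simp flip: power_Suc)
  have "card (generate G {a, a1, a2, a3, a4}) = p * card A"
    using notin by (intro card_generate_insert[OF prime]) (auto simp: comm gen pow)
  with 4 show "Coset.order G = p ^ 5"
    by (simp add: Coset.order_def generate_gens flip: power_Suc)
qed

section \<open>Normality and commutators along the flag\<close>

lemma normals: "Z \<lhd> G" "D \<lhd> G" "A \<lhd> G"
  by (rule normal_generate_commutator[OF _ _ generate_gens];
      use finite_subs in \<open>auto simp: comm gen\<close>)+

lemma commutator_A: "y \<in> A \<Longrightarrow> x \<in> A \<Longrightarrow> commutator G y x \<in> D"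
  by (erule commutator_generate[OF normals(2), rotated 3]) (auto simp: comm gen)

lemma commutator_E_A: "y \<in> E \<Longrightarrow> x \<in> A \<Longrightarrow> commutator G y x \<in> Z"
  by (erule commutator_generate[OF normals(1), rotated 3]) (auto simp: comm gen)

lemma commutator_E_a: "y \<in> E \<Longrightarrow> commutator G y a \<in> D"
  by (erule commutator_generate[OF normals(2), where T = "{a}", rotated 3]) (auto simp: comm gen)

lemma commutator_D_a: "y \<in> D \<Longrightarrow> commutator G y a \<in> Z"
  by (erule commutator_generate[OF normals(1), where T = "{a}", rotated 3]) (auto simp: comm gen)

text \<open>A descent A, E, D, Z by three uses of \<open>commutator_notin\<close>. The triples (P,
  Q, K) are (A, E, D), (E, D, Z) and (D, Z, 1), with witnesses u = a1, a2, a3: in each case [u, a]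
  is the next generator, which lies outside K. As [y, x] = 1 lies in every K, y cannot stop in any
  of the layers P - Q.\<close>

lemma commute_outside_A:
  assumes x: "x \<in> carrier G" "x \<notin> A" and y: "y \<in> A" and "commute y x"
  shows "y \<in> Z"
proof -
  have one: "commutator G y x = \<one>"
    using assms subs_carrier by (simp add: commutator_eq_one_iff)
  have order: "Coset.order G = p * card A" by (simp add: cards flip: power_Suc)
  \<comment> \<open>Fixes the common data of the three uses: the subgroup A of index p, the test
    element \<alpha>, and x.\<close>
  note notin_rule = commutator_notin[OF finite prime _ _ _ subgroups(4) _ _ order,
      OF _ _ _ _ _ _ _ _ _ in_carrier(1) _ _ x]
  have "y \<in> E"
  proof (rule ccontr)
    assume "y \<notin> E"
    have "commutator G y x \<notin> D"
    proof (rule notin_rule[OF normals(2) subgroups(3,4) flag(3)])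
      show "card A = p * card E" by (simp add: cards flip: power_Suc)
      show "a1 \<in> A" "commutator G a1 a \<notin> D" using notin by (auto simp: gen comm)
    qed (use commutator_A commutator_E_a y \<open>y \<notin> E\<close> in auto)
    then show False using one by (simp add: gen)
  qed
  have "y \<in> D"
  proof (rule ccontr)
    assume "y \<notin> D"
    have "commutator G y x \<notin> Z"
    proof (rule notin_rule[OF normals(1) subgroups(2,3) flag(2)])
      show "card E = p * card D" by (simp add: cards flip: power_Suc)
      show "a2 \<in> E" "commutator G a2 a \<notin> Z" using notin by (auto simp: gen comm)
    qed (use commutator_E_A commutator_D_a \<open>y \<in> E\<close> \<open>y \<notin> D\<close> in auto)
    then show False using one by (simp add: gen)
  qed
  show "y \<in> Z"
  proof (rule ccontr)
    assume "y \<notin> Z"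
    have "commutator G y x \<notin> {\<one>}"
    proof (rule notin_rule[OF one_is_normal subgroups(1,2) flag(1)])
      show "card D = p * card Z" by (simp add: cards power2_eq_square)
      show "a3 \<in> D" "commutator G a3 a \<notin> {\<one>}" using a4_neq_one by (auto simp: gen comm)
      show "commutator G u v \<in> {\<one>}" if "u \<in> D" "v \<in> A" for u v
        using D_A_commute[OF that] that subs_carrier by (simp add: commutator_eq_one_iff)
      show "commutator G u a \<in> {\<one>}" if "u \<in> Z" for u
        using Z_commute[OF that in_carrier(1)] that subs_carrier
        by (simp add: commutator_eq_one_iff)
    qed (use \<open>y \<in> D\<close> \<open>y \<notin> Z\<close> in auto)
    then show False using one by simp
  qed
qed

text \<open>A central element outside A would, by \<open>commute_outside_A\<close>, force a3 into Z.
  Hence a central element lies in A, and since it commutes with a, which is outside A, it lies in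
  Z.\<close>

lemma center_eq: "center G = Z"
proof
  show "Z \<subseteq> center G"
    using Z_commute subs_carrier by (fastforce simp: center_def)
  show "center G \<subseteq> Z"
  proof
    fix z assume z: "z \<in> center G"
    then have c: "z \<in> carrier G" "\<And>g. g \<in> carrier G \<Longrightarrow> commute g z" by (auto simp: center_def)
    have "z \<in> A"
    proof (rule ccontr)
      assume "z \<notin> A"
      then have "a3 \<in> Z" using c by (intro commute_outside_A[of z]) (auto simp: gen)
      then show False using notin by simp
    qed
    then show "z \<in> Z" using commute_outside_A[of a z] notin c(2)[OF in_carrier(1)] by simp
  qed
qed

section \<open>Centralizers in the layers D - Z, A - D and G - A\<close>

lemma centralizer_D:
  assumes g: "g \<in> D" "g \<notin> Z"
  shows "{y \<in> carrier G. commute g y} = A"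
proof
  show "{y \<in> carrier G. commute g y} \<subseteq> A"
    using commute_outside_A[of _ g] g flag by auto
  show "A \<subseteq> {y \<in> carrier G. commute g y}"
    using D_A_commute[OF g(1)] subs_carrier by blast
qed

lemma centralizer_A_subset:
  assumes g: "g \<in> A" "g \<notin> D"
  shows "{y \<in> carrier G. commute g y} \<subseteq> A"
  using commute_outside_A[of _ g] g flag by auto

text \<open>Suppose g centralizes A. If g is outside E, then g and the abelian group E centralize
  a2, hence so does all of A, including a1. If g is in E - D, then g and D centralize a1, hence so
  does all of E, including a2. Both contradict [a1, a2] = a4.\<close>

lemma A_not_centralized:
  assumes g: "g \<in> A" "g \<notin> D"
  shows "\<not> A \<subseteq> {y \<in> carrier G. commute g y}"
proof
  assume all: "A \<subseteq> {y \<in> carrier G. commute g y}"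
  have "g \<in> E"
  proof (rule ccontr)
    assume "g \<notin> E"
    have "A \<inter> {y \<in> carrier G. commute a2 y} = A"
    proof (rule prime_index_maximal[OF subgroups(3) subgroups_Inter_pair subgroups(4)])
      show "subgroup {y \<in> carrier G. commute a2 y} G" by (rule subgroup_centralizer) simp
      show "E \<subseteq> A \<inter> {y \<in> carrier G. commute a2 y}"
        using flag subs_carrier E_commute[of a2] by (auto simp: gen)
      show "card A = p * card E" by (simp add: cards flip: power_Suc)
      show "g \<in> A \<inter> {y \<in> carrier G. commute a2 y}"
        using all g subs_carrier generate.incl[of a2 "{a1, a2, a3, a4}" G] by auto
    qed (use finite_subs prime subgroups \<open>g \<notin> E\<close> in auto)
    moreover have "a1 \<in> A" by (simp add: gen)
    ultimately show False using not_commute by blast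
  qed
  have "E \<inter> {y \<in> carrier G. commute a1 y} = E"
  proof (rule prime_index_maximal[OF subgroups(2) subgroups_Inter_pair subgroups(3)])
    show "subgroup {y \<in> carrier G. commute a1 y} G" by (rule subgroup_centralizer) simp
    show "D \<subseteq> E \<inter> {y \<in> carrier G. commute a1 y}"
      using flag subs_carrier D_A_commute[of _ a1] by (auto simp: gen)
    show "card E = p * card D" by (simp add: cards flip: power_Suc)
    show "g \<in> E \<inter> {y \<in> carrier G. commute a1 y}"
      using all g \<open>g \<in> E\<close> subs_carrier generate.incl[of a1 "{a1, a2, a3, a4}" G] by auto
  qed (use finite_subs prime subgroups g in auto)
  moreover have "a2 \<in> E" by (simp add: gen)
  ultimately show False using not_commute by blast
qed

text \<open>The centralizer lies strictly between D, which misses g, and A, which is not centralized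
  by g; D has index p^2 in A.\<close>

lemma card_centralizer_A:
  assumes g: "g \<in> A" "g \<notin> D"
  shows "card {y \<in> carrier G. commute g y} = p ^ 3"
proof -
  have gc: "g \<in> carrier G" using g subs_carrier by blast
  have "D \<subseteq> {y \<in> carrier G. commute g y}"
    using D_A_commute[OF _ g(1)] subs_carrier by fastforce
  moreover have "g \<in> {y \<in> carrier G. commute g y}" using gc by simp
  ultimately have "card {y \<in> carrier G. commute g y} = p * card D"
    using centralizer_A_subset[OF g] A_not_centralized[OF g] g finite_subs prime
    by (intro card_strictly_between[OF subgroups(2) subgroup_centralizer[OF gc] subgroups(4)])
      (auto simp: cards simp flip: power_add)
  then show ?thesis by (simp add: cards flip: power_Suc)
qed

text \<open>D has index p in the centralizer of g, so D and g generate it. Any y in it lies in A,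
  hence commutes with D, and it commutes with g, so it commutes with the whole centralizer.\<close>

lemma centralizer_A_commute:
  assumes g: "g \<in> A" "g \<notin> D" and y: "y \<in> carrier G" "commute g y"
    and z: "z \<in> carrier G" "commute g z"
  shows "commute y z"
proof -
  have gc: "g \<in> carrier G" using g subs_carrier by blast
  have yA: "y \<in> A" using centralizer_A_subset[OF g] y by auto
  have "{v \<in> carrier G. commute g v} \<inter> {v \<in> carrier G. commute y v} = {v \<in> carrier G. commute g v}"
  proof (rule prime_index_maximal[OF subgroups(2) subgroups_Inter_pair])
    show "D \<subseteq> {v \<in> carrier G. commute g v} \<inter> {v \<in> carrier G. commute y v}"
      using D_A_commute[OF _ g(1)] D_A_commute[OF _ yA] subs_carrier by fastforce
    show "g \<in> {v \<in> carrier G. commute g v} \<inter> {v \<in> carrier G. commute y v}"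
      using gc y by auto
    show "card {v \<in> carrier G. commute g v} = p * card D"
      using card_centralizer_A[OF g] by (simp add: cards flip: power_Suc)
  qed (use g gc y finite prime subgroup_centralizer in auto)
  then show ?thesis using z by blast
qed

text \<open>Every element has the form g^i k with k in A. It commutes with g exactly if k does, and
  then k lies in Z by \<open>commute_outside_A\<close>. So the centralizer is generated by g and
  Z.\<close>

lemma centralizer_outside_A:
  assumes g: "g \<in> carrier G" "g \<notin> A"
  shows "{y \<in> carrier G. commute g y} = generate G {g, a4}"
    and "card {y \<in> carrier G. commute g y} = p\<^sup>2"
proof -
  have comm_g: "commutator G a4 g = \<one>"
    using Z_commute[of a4 g] g by (simp add: gen commutator_eq_one_iff)
  have pow_comm: "commute (g [^] i) g" for i :: nat
    using nat_pow_Suc2[OF g(1), of i] nat_pow_Suc[of g i] by simp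
  have "Coset.order G = p * card A" by (simp add: cards flip: power_Suc)
  then have gpA: "g [^] p \<in> A" using pow_prime_index_mem[OF normals(3) finite _ g(1)] by blast
  \<comment> \<open>The p-th power of g lies in A and commutes with g, which is outside A.\<close>
  then have gpZ: "g [^] p \<in> Z"
    using pow_comm by (intro commute_outside_A[OF g]) auto
  have gZ: "g \<notin> Z" using g flag by auto
  have card_g: "card (generate G {g, a4}) = p * card Z"
    using g gpZ gZ comm_g
    by (intro card_generate_insert[OF prime]) (auto simp: gen)
  interpret nA: normal A G by (rule normals)
  have comm_A: "commutator G s g \<in> A" if "s \<in> {a1, a2, a3, a4}" for s
  proof -
    have "s \<in> A" using that by (rule generate.incl)
    then have "inv s \<otimes> (inv g \<otimes> s \<otimes> g) \<in> A"
      using g nA.inv_op_closed1 nA.m_closed nA.m_inv_closed by simp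
    then show ?thesis using g \<open>s \<in> A\<close> subs_carrier by (simp add: commutator_def m_assoc)
  qed
  \<comment> \<open>Here g takes over the part of \<alpha> as the generator adjoined to A.\<close>
  have form: "generate G (insert g {a1, a2, a3, a4}) = (\<lambda>(i, k). g [^] i \<otimes> k) ` ({..<p} \<times> A)"
    using g gpA comm_A by (intro generate_insert_normalizing[OF prime]) auto
  have "card (generate G (insert g {a1, a2, a3, a4})) = p * card A"
    using g gpA comm_A by (intro card_generate_insert[OF prime]) auto
  then have "card (generate G (insert g {a1, a2, a3, a4})) = card (carrier G)"
    using cards by (simp add: Coset.order_def flip: power_Suc)
  then have gen_all: "generate G (insert g {a1, a2, a3, a4}) = carrier G"
    using g finite by (intro card_subset_eq generate_incl) auto
  have sub: "subgroup (generate G {g, a4}) G" using g by (intro generate_is_subgroup) auto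
  show eq: "{y \<in> carrier G. commute g y} = generate G {g, a4}"
  proof
    show "generate G {g, a4} \<subseteq> {y \<in> carrier G. commute g y}"
      using g Z_commute[of a4 g] by (intro generate_subgroup_incl subgroup_centralizer) (auto simp: gen)
    show "{y \<in> carrier G. commute g y} \<subseteq> generate G {g, a4}"
    proof
      fix y assume y: "y \<in> {y \<in> carrier G. commute g y}"
      then have "y \<in> (\<lambda>(i, k). g [^] i \<otimes> k) ` ({..<p} \<times> A)"
        using gen_all form by simp
      then obtain i :: nat and k where k: "y = g [^] i \<otimes> k" "k \<in> A" by auto
      have gi: "g [^] i \<in> generate G {g, a4}"
        using subgroup_int_pow_closed[OF sub, of g "int i"] by (simp add: int_pow_int gen)
      have kc: "k \<in> carrier G" using k subs_carrier by blast
      have "g [^] i \<otimes> (g \<otimes> k) = g \<otimes> (g [^] i \<otimes> k)"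
        using g kc pow_comm[of i] by (simp flip: m_assoc)
      also have "\<dots> = g [^] i \<otimes> (k \<otimes> g)"
        using y k g kc by (simp add: m_assoc)
      finally have "commute k g" using g kc by simp
      then have "k \<in> Z" using commute_outside_A[OF g k(2)] by blast
      then have "k \<in> generate G {g, a4}" using mono_generate[of "{a4}" "{g, a4}"] by blast
      then show "y \<in> generate G {g, a4}" unfolding k(1) using gi by (intro generate.eng)
    qed
  qed
  then show "card {y \<in> carrier G. commute g y} = p\<^sup>2"
    using card_g by (simp add: cards power2_eq_square)
qed

lemma centralizer_outside_A_commute:
  assumes g: "g \<in> carrier G" "g \<notin> A" and y: "y \<in> carrier G" "commute g y"
    and z: "z \<in> carrier G" "commute g z"
  shows "commute y z"
proof (rule commute_generate)
  show "y \<in> generate G {g, a4}" "z \<in> generate G {g, a4}"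
    using centralizer_outside_A(1)[OF g] y z by auto
  have "commute a4 g" using Z_commute[of a4 g] g by (simp add: gen)
  then show "commutator G s t = \<one>" if "s \<in> {g, a4}" "t \<in> {g, a4}" for s t
    using that g by (auto simp: commutator_eq_one_iff)
qed (use g in auto)

end

text \<open>The flag in K consists of the preimages of A, D and Z under the transversal f.
  Centralizers in K are preimages of centralizers in G, because f preserves and reflects
  commutation.\<close>

lemma (in phi10_nontrivial) isoclinic_commuting_flag:
  fixes K :: "('c, 'd) monoid_scheme"
  assumes "group K" "finite (carrier K)" "isoclinic K G"
  shows "\<exists>A' D' Z'. commuting_flag (\<lambda>x y. x \<otimes>\<^bsub>K\<^esub> y = y \<otimes>\<^bsub>K\<^esub> x) (carrier K) A' D' Z' p (card (center K))"
proof -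
  interpret K: group K by fact
  obtain f where f: "f \<in> carrier K \<rightarrow> carrier G"
    and f_comm: "\<And>x y. x \<in> carrier K \<Longrightarrow> y \<in> carrier K \<Longrightarrow> K.commute x y \<longleftrightarrow> commute (f x) (f y)"
    and f_card: "\<And>S. S \<subseteq> carrier G \<Longrightarrow> (\<And>z s. z \<in> center G \<Longrightarrow> s \<in> S \<Longrightarrow> z \<otimes> s \<in> S) \<Longrightarrow>
      card {g \<in> carrier K. f g \<in> S} * card (center G) = card S * card (center K)"
    using isoclinic_transversal[OF assms(1) is_group assms(3,2) finite] by blast
  define pre where "pre = (\<lambda>S. {g \<in> carrier K. f g \<in> S})"
  have fc: "f x \<in> carrier G" if "x \<in> carrier K" for x using f that by blast
  \<comment> \<open>As Z, the centre of G, has order p, the factor k is the index of Z in S.\<close>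
  have card_pre: "card (pre S) = k * card (center K)"
    if "subgroup S G" "Z \<subseteq> S" "card S = p * k" for S k
  proof -
    have "card (pre S) * p = card S * card (center K)"
      using f_card[of S] that subgroup.subset subgroup.m_closed
      unfolding pre_def center_eq cards(1) by (metis subsetD)
    then show ?thesis using that(3) prime_gt_0_nat[OF prime] by simp
  qed
  have cent: "{y \<in> carrier K. K.commute x y} = pre {v \<in> carrier G. commute (f x) v}"
    if "x \<in> carrier K" for x
    using that f_comm fc by (auto simp: pre_def)
  have card_cent: "card {y \<in> carrier K. K.commute x y} = k * card (center K)"
    if "x \<in> carrier K" "card {v \<in> carrier G. commute (f x) v} = p * k" for x k
    unfolding cent[OF that(1)]
  proof (rule card_pre[OF _ _ that(2)])
    show "subgroup {v \<in> carrier G. commute (f x) v} G" using that fc by (intro subgroup_centralizer)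
    show "Z \<subseteq> {v \<in> carrier G. commute (f x) v}"
      using that fc Z_commute subs_carrier by fastforce
  qed
  have "commuting_flag K.commute (carrier K) (pre A) (pre D) (pre Z) p (card (center K))"
  proof (unfold_locales; (elim DiffE)?)
    show "pre Z \<subseteq> pre D" "pre D \<subseteq> pre A" "pre A \<subseteq> carrier K"
      using flag by (auto simp: pre_def)
    show "card (pre Z) = card (center K)"
      using card_pre[OF subgroups(1), of 1] by (simp add: cards)
    show "card (pre D) = p * card (center K)"
      using card_pre[OF subgroups(2) flag(1)] by (simp add: cards power2_eq_square)
    show "card (pre A) = p ^ 3 * card (center K)"
      using card_pre[OF subgroups(4), of "p ^ 3"] flag by (simp add: cards flip: power_Suc)
    have "pre (carrier G) = carrier K" using fc by (auto simp: pre_def)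
    then show "card (carrier K) = p ^ 4 * card (center K)"
      using card_pre[OF subgroup_self, of "p ^ 4"] subs_carrier cards(5)
      by (auto simp: Coset.order_def simp flip: power_Suc)
  next
    fix x y assume "x \<in> pre Z" "y \<in> carrier K"
    then show "K.commute x y" using Z_commute[of "f x" "f y"] fc f_comm by (simp add: pre_def)
  next
    fix x assume "x \<in> pre D" "x \<notin> pre Z"
    then show "{y \<in> carrier K. K.commute x y} = pre A"
      using cent[of x] centralizer_D[of "f x"] by (simp add: pre_def)
  next
    fix x assume "x \<in> pre A" "x \<notin> pre D"
    then have x: "x \<in> carrier K" "f x \<in> A" "f x \<notin> D" by (auto simp: pre_def)
    show "{y \<in> carrier K. K.commute x y} \<subseteq> pre A"
      using cent[OF x(1)] centralizer_A_subset[OF x(2,3)] by (auto simp: pre_def)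
    show "card {y \<in> carrier K. K.commute x y} = p\<^sup>2 * card (center K)"
      using card_cent[OF x(1), of "p\<^sup>2"] card_centralizer_A[OF x(2,3)] by (simp flip: power_Suc)
    fix y z assume "y \<in> carrier K" "z \<in> carrier K" "K.commute x y" "K.commute x z"
    then show "K.commute y z"
      using centralizer_A_commute[OF x(2,3), of "f y" "f z"] x(1) fc f_comm by simp
  next
    fix x assume "x \<in> carrier K" "x \<notin> pre A"
    then have x: "x \<in> carrier K" "f x \<in> carrier G" "f x \<notin> A" using fc by (auto simp: pre_def)
    show "card {y \<in> carrier K. K.commute x y} = p * card (center K)"
      using card_cent[OF x(1), of p] centralizer_outside_A(2)[OF x(2,3)]
      by (simp add: power2_eq_square)
    fix y z assume "y \<in> carrier K" "z \<in> carrier K" "K.commute x y" "K.commute x z"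
    then show "K.commute y z"
      using centralizer_outside_A_commute[OF x(2,3), of "f y" "f z"] x(1) fc f_comm by simp
  qed (use assms(2) in auto)
  then show ?thesis by blast
qed

section \<open>The presentation\<close>

definition word_class :: "'a word set \<Rightarrow> 'a word \<Rightarrow> 'a word set" where
  "word_class R u = {w. pres_eq R u w}"

context
  fixes R :: "'a word set"
begin

interpretation group "presented_group R" by (rule group_presented_group)

lemma word_class_closed [simp]: "word_class R u \<in> carrier (presented_group R)"
  by (auto simp: word_class_def carrier_presented_group)

lemma word_class_append:
  "word_class R (u @ v) = word_class R u \<otimes>\<^bsub>presented_group R\<^esub> word_class R v"
  by (simp add: word_class_def mult_presented_group)

lemma word_class_Nil: "word_class R [] = \<one>\<^bsub>presented_group R\<^esub>"
  by (simp add: word_class_def presented_group_def)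

lemma word_class_eqI: "pres_eq R u v \<Longrightarrow> word_class R u = word_class R v"
  by (auto simp: word_class_def intro: pres_eq.trans pres_eq.sym)

lemma word_class_relator: "r \<in> R \<Longrightarrow> word_class R r = \<one>\<^bsub>presented_group R\<^esub>"
  using word_class_eqI[OF pres_eq.relator[of r R "[]" "[]"]] by (simp add: word_class_Nil)

lemma word_class_inv: "word_class R (word_inv u) = inv\<^bsub>presented_group R\<^esub> word_class R u"
  using word_class_eqI[OF pres_eq_word_inv[of R u]]
  by (intro inv_equality[symmetric]) (simp_all add: word_class_append word_class_Nil)

lemma word_class_comm:
  "word_class R (word_comm u v) = commutator (presented_group R) (word_class R u) (word_class R v)"
  by (simp add: word_comm_def commutator_def word_class_append word_class_inv m_assoc)

lemma word_class_pow:
  "word_class R (word_pow u n) = word_class R u [^]\<^bsub>presented_group R\<^esub> n"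
  unfolding word_pow_def
proof (induction n)
  case (Suc n)
  then show ?case
    using nat_pow_Suc2[of "word_class R u" n] by (simp add: word_class_append)
qed (simp add: word_class_Nil)

lemma word_class_comm_eq:
  assumes "word_comm u v @ word_inv w \<in> R"
  shows "commutator (presented_group R) (word_class R u) (word_class R v) = word_class R w"
proof -
  have "commutator (presented_group R) (word_class R u) (word_class R v)
      \<otimes>\<^bsub>presented_group R\<^esub> inv\<^bsub>presented_group R\<^esub> word_class R w = \<one>\<^bsub>presented_group R\<^esub>"
    using word_class_relator[OF assms] by (simp add: word_class_append word_class_comm word_class_inv)
  then show ?thesis using inv_solve_right' commutator_closed word_class_closed one_closed l_one
    by metis
qed

lemma word_class_comm_eq_one:
  "word_comm u v \<in> R \<Longrightarrow>
    commutator (presented_group R) (word_class R u) (word_class R v) = \<one>\<^bsub>presented_group R\<^esub>"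
  using word_class_relator[of "word_comm u v"] by (simp add: word_class_comm)

lemma generate_letters:
  "generate (presented_group R) (range (\<lambda>x. word_class R [(x, True)])) = carrier (presented_group R)"
    (is "?L = _")
proof
  have sub: "subgroup ?L (presented_group R)" by (intro generate_is_subgroup) auto
  then show "?L \<subseteq> carrier (presented_group R)" by (rule subgroup.subset)
  have letter: "word_class R [(x, b)] \<in> ?L" for x b
  proof (cases b)
    case False
    have "[(x, False)] = word_inv [(x, True)]" by (simp add: word_inv_def)
    then show ?thesis using False by (simp add: word_class_inv generate.inv)
  qed (auto intro: generate.incl)
  have "word_class R u \<in> ?L" for u
  proof (induction u)
    case (Cons l u)
    have "word_class R (l # u) = word_class R [l] \<otimes>\<^bsub>presented_group R\<^esub> word_class R u"
      using word_class_append[of "[l]" u] by simp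
    then show ?case using Cons letter[of "fst l" "snd l"] by (simp add: generate.eng)
  qed (simp add: word_class_Nil generate.one)
  then show "carrier (presented_group R) \<subseteq> ?L"
    by (auto simp: carrier_presented_group word_class_def)
qed

lemma word_class_concat_generate:
  assumes "\<And>w. w \<in> set ws \<Longrightarrow> word_class R w \<in> generate (presented_group R) S"
  shows "word_class R (concat ws) \<in> generate (presented_group R) S"
  using assms by (induction ws) (auto simp: word_class_Nil word_class_append intro: generate.intros)

end

text \<open>The relator \<open>al_ppow p i\<close> has the form \<alpha>_{i+1}^p v with v a word in
  later generators, so the p-th power equals the inverse of the class of v.\<close>

lemma phi10_pow_mem_generate:
  fixes p i :: nat and S
  defines "H \<equiv> presented_group (phi10_relators p)" and "c \<equiv> word_class (phi10_relators p)"
  assumes "prime p" "i \<in> {0, 1, 2, 3}" "S \<subseteq> carrier H"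
    and S: "(\<lambda>j. c (al j)) ` {i + 1<..4} \<subseteq> S"
  shows "c (al (i + 1)) [^]\<^bsub>H\<^esub> p \<in> generate H S"
proof -
  interpret group H unfolding H_def by (rule group_presented_group)
  let ?ws = "map (\<lambda>k. word_pow (al (i + k)) (p choose k)) [2..<Suc p]"
  have sub: "subgroup (generate H S) H" using assms(5) by (rule generate_is_subgroup)
  \<comment> \<open>The factor k = 1 has exponent \<open>p choose 1\<close>, which is p; the others
    start with \<open>al (i + 2)\<close>.\<close>
  have "al_ppow p i = word_pow (al (i + 1)) p @ concat ?ws"
    using prime_gt_1_nat[OF assms(3)] unfolding al_ppow_def
    by (subst upt_conv_Cons) (auto simp: numeral_2_eq_2)
  moreover have "al_ppow p i \<in> phi10_relators p"
    using assms(4) unfolding phi10_relators_def by blast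
  ultimately have eq: "c (al (i + 1)) [^]\<^bsub>H\<^esub> p \<otimes>\<^bsub>H\<^esub> c (concat ?ws) = \<one>\<^bsub>H\<^esub>"
    using word_class_relator[of "al_ppow p i" "phi10_relators p"]
    by (simp add: word_class_append word_class_pow H_def c_def)
  \<comment> \<open>Indices beyond 4 do occur in the relator; there \<open>al j\<close> is the empty
    word and contributes the identity.\<close>
  have al: "c (al j) \<in> generate H S" if "i + 2 \<le> j" for j
  proof (cases "j \<le> 4")
    case True
    then show ?thesis using S that by (intro generate.incl) auto
  next
    case False
    then have "al j = []" by (simp add: al_def)
    then show ?thesis by (simp add: c_def H_def word_class_Nil generate.one)
  qed
  have "c (al j) [^]\<^bsub>H\<^esub> n \<in> generate H S" if "i + 2 \<le> j" for j and n :: nat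
    using subgroup_int_pow_closed[OF sub al[OF that], of "int n"] by (simp add: int_pow_int)
  then have "c (concat ?ws) \<in> generate H S"
    unfolding c_def H_def by (intro word_class_concat_generate) (auto simp: word_class_pow simp del: upt_Suc)
  moreover have "c (al (i + 1)) [^]\<^bsub>H\<^esub> p = inv\<^bsub>H\<^esub> c (concat ?ws)"
    by (intro inv_equality[symmetric] eq nat_pow_closed) (simp_all add: c_def H_def)
  ultimately show ?thesis using subgroup.m_inv_closed[OF sub] by simp
qed

lemma phi10_relations_presented:
  fixes p :: nat
  defines "c \<equiv> word_class (phi10_relators p)"
  assumes "prime p"
  shows "phi10_relations (Phi10_group p) p (c [(Al, True)]) (c (al 1)) (c (al 2)) (c (al 3)) (c (al 4))"
proof -
  let ?R = "phi10_relators p"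
  let ?c = "word_class ?R"
  interpret group "presented_group ?R" by (rule group_presented_group)
  have al5: "?c (al 5) = \<one>\<^bsub>presented_group ?R\<^esub>" by (simp add: al_def word_class_Nil)
  have r: "word_comm (al i) [(Al, True)] @ word_inv (al (i + 1)) \<in> ?R" if "i \<in> {1, 2, 3}" for i
    using that unfolding phi10_relators_def by blast
  have "commutator (presented_group ?R) (?c (al i)) (?c (al j)) = \<one>\<^bsub>presented_group ?R\<^esub>"
    if "(i, j) \<in> {(1, 3), (1, 4), (2, 3), (2, 4), (3, 4)}" for i j
    using that unfolding phi10_relators_def by (intro word_class_comm_eq_one) blast
  note trivial = this
  have range: "range (\<lambda>x. ?c [(x, True)]) = {?c [(Al, True)], ?c (al 1), ?c (al 2), ?c (al 3), ?c (al 4)}"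
  proof -
    have UNIV: "(UNIV :: phi10_gen set) = {Al, Al1, Al2, Al3, Al4}"
      using phi10_gen.exhaust by auto
    show ?thesis unfolding UNIV by (simp add: al_def)
  qed
  have "phi10_relations (presented_group ?R) p (?c [(Al, True)]) (?c (al 1)) (?c (al 2)) (?c (al 3)) (?c (al 4))"
  proof
    show "generate (presented_group ?R) {?c [(Al, True)], ?c (al 1), ?c (al 2), ?c (al 3), ?c (al 4)}
        = carrier (presented_group ?R)"
      using generate_letters[of ?R] unfolding range .
    show "commutator (presented_group ?R) (?c (al 1)) (?c [(Al, True)]) = ?c (al 2)"
      using word_class_comm_eq[OF r[of 1]] by (simp add: numeral_2_eq_2)
    show "commutator (presented_group ?R) (?c (al 2)) (?c [(Al, True)]) = ?c (al 3)"
      using word_class_comm_eq[OF r[of 2]] by simp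
    show "commutator (presented_group ?R) (?c (al 3)) (?c [(Al, True)]) = ?c (al 4)"
      using word_class_comm_eq[OF r[of 3]] by simp
    show "commutator (presented_group ?R) (?c (al 4)) (?c [(Al, True)]) = \<one>\<^bsub>presented_group ?R\<^esub>"
      by (rule word_class_comm_eq_one) (simp add: phi10_relators_def)
    show "commutator (presented_group ?R) (?c (al 1)) (?c (al 2)) = ?c (al 4)"
      by (rule word_class_comm_eq) (simp add: phi10_relators_def)
    have "?c [(Al, True)] [^]\<^bsub>presented_group ?R\<^esub> p = \<one>\<^bsub>presented_group ?R\<^esub>"
      unfolding word_class_pow[symmetric] by (rule word_class_relator) (simp add: phi10_relators_def)
    then show "?c [(Al, True)] [^]\<^bsub>presented_group ?R\<^esub> p
        \<in> generate (presented_group ?R) {?c (al 1), ?c (al 2), ?c (al 3), ?c (al 4)}"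
      by (simp add: generate.one)
    have int: "{1<..4} = {2, 3, 4 :: nat}" "{2<..4} = {3, 4 :: nat}" "{3<..4} = {4 :: nat}"
      "{4<..4} = ({} :: nat set)" by auto
    note pow_mem = phi10_pow_mem_generate[OF assms(2)]
    show "?c (al 1) [^]\<^bsub>presented_group ?R\<^esub> p
        \<in> generate (presented_group ?R) {?c (al 2), ?c (al 3), ?c (al 4)}"
      using pow_mem[of 0, simplified] int by simp
    show "?c (al 2) [^]\<^bsub>presented_group ?R\<^esub> p
        \<in> generate (presented_group ?R) {?c (al 3), ?c (al 4)}"
      using pow_mem[of 1] int by (simp add: numeral_2_eq_2)
    show "?c (al 3) [^]\<^bsub>presented_group ?R\<^esub> p \<in> generate (presented_group ?R) {?c (al 4)}"
      using pow_mem[of 2] int by simp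
    show "?c (al 4) [^]\<^bsub>presented_group ?R\<^esub> p \<in> generate (presented_group ?R) {}"
      using pow_mem[of 3] int by simp
  qed (auto simp: assms(2) trivial)
  then show ?thesis by (simp add: Phi10_group_def c_def)
qed

section \<open>The generating functions\<close>

theorem lemma5p9:
  fixes G :: "('a, 'b) monoid_scheme" and p m :: nat
  assumes "prime p" and "odd p"
    and "group G" and "Coset.order G = p ^ m"
    and "isoclinism_rank p G = 5"
    and "in_Phi10 p G"
  shows "(fps_compose (A_fps G) (fps_const (1 / real (Coset.order G)) * fps_X) =
        fps_const (1 - real p powi (-1)) / (1 - fps_const (real p powi (-3)) * fps_X)
      + fps_const (real p powi (-1) - real p powi (-3)) / (1 - fps_const (real p powi (-2)) * fps_X)
      + fps_const (real p powi (-3) - real p powi (-4)) / (1 - fps_const (real p powi (-1)) * fps_X)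
      + fps_const (real p powi (-4)) / (1 - fps_X))
    \<and> (fps_compose (B_fps G) (fps_const (1 / real (Coset.order G)) * fps_X) =
        fps_const (- (real p powi (-1))) / (1 - fps_const (real p powi (-4)) * fps_X)
      + fps_const (1 - real p powi (-2)) / (1 - fps_const (real p powi (-3)) * fps_X)
      + fps_const (real p powi (-1) + real p powi (-2)) / (1 - fps_const (real p powi (-2)) * fps_X))"
proof -
  interpret G: group G by fact
  have p: "p > 0" using assms(1) by (rule prime_gt_0_nat)
  then have finite: "finite (carrier G)"
    using assms(4) G.order_gt_0_iff_finite by simp
  have iso: "isoclinic G (Phi10_group p)" using assms(6) by (simp add: in_Phi10_def)
  let ?c = "word_class (phi10_relators p)"
  interpret H: phi10_relations "Phi10_group p" p "?c [(Al, True)]" "?c (al 1)" "?c (al 2)" "?c (al 3)"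
    "?c (al 4)"
    using assms(1) by (rule phi10_relations_presented)
  have "?c (al 4) \<noteq> \<one>\<^bsub>Phi10_group p\<^esub>"
  proof
    assume "?c (al 4) = \<one>\<^bsub>Phi10_group p\<^esub>"
    then obtain r where r: "r \<le> 4" "Coset.order (Phi10_group p) = p ^ r"
      using H.order_power_if_trivial by blast
    then have "finite (carrier (Phi10_group p))" using p H.order_gt_0_iff_finite by simp
    from isoclinism_rank_le[OF assms(3) H.is_group this r(2) iso] show False
      using r(1) assms(5) by simp
  qed
  then interpret H: phi10_nontrivial "Phi10_group p" p "?c [(Al, True)]" "?c (al 1)" "?c (al 2)"
    "?c (al 3)" "?c (al 4)"
    by unfold_locales
  define w where "w = card (center G)"
  obtain A D Z where "commuting_flag G.commute (carrier G) A D Z p w"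
    using H.isoclinic_commuting_flag[OF assms(3) finite iso] unfolding w_def by blast
  then interpret commuting_flag G.commute "carrier G" A D Z p w .
  have order: "real (Coset.order G) = real p ^ 4 * w"
    by (simp add: Coset.order_def cards)
  have w: "w > 0" using assms(4) p cards(4) by (auto simp: Coset.order_def intro: gr0I)
  \<comment> \<open>The order p^4 w cancels w from each centralizer order p^k w, leaving the ratio
    p^{k-4}; these ratios are the poles' reciprocals in the two formulas.\<close>
  have ratio: "(1 / (real p ^ 4 * w)) ^ n * (real p ^ k * w) ^ n = (1 / real p ^ (4 - k)) ^ n"
    if "k \<le> 4" for k n
  proof -
    have "real p ^ 4 = real p ^ (4 - k) * real p ^ k" using that by (simp flip: power_add)
    then show ?thesis using p w by (simp flip: power_mult_distrib)
  qed
  note ratios = ratio[of 4, simplified] ratio[of 3, simplified] ratio[of 2, simplified]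
    ratio[of 1, simplified] ratio[of 0, simplified]
  have alpha: "real (alpha G n) * (real p ^ 4 * w) =
      w * (real p ^ 4 * w) ^ n + (real p * w - w) * (real p ^ 3 * w) ^ n
      + (real p ^ 3 * w - real p * w) * (real p ^ 2 * w) ^ n
      + (real p ^ 4 * w - real p ^ 3 * w) * (real p * w) ^ n" for n
    unfolding sum_card_cent_power[symmetric] of_nat_sum[symmetric]
      G.alpha_burnside[OF finite, symmetric]
    by (simp add: order)
  have beta: "real (beta G n) * (real p ^ 4 * w) = (real p + 1) * (real p ^ 2 * w) ^ Suc n
    + (real p ^ 3 - real p) * (real p * w) ^ Suc n - real p ^ 3 * real w ^ Suc n" for n
    using G.beta_burnside[OF finite, of n] card_comm_lists_X[of "Suc n"] order
    by (metis of_nat_mult)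
  have A_coeff: "(1 / (real p ^ 4 * w)) ^ n * real (alpha G n) =
      (1 - 1 / real p) * (1 / real p ^ 3) ^ n + (1 / real p - 1 / real p ^ 3) * (1 / real p ^ 2) ^ n
      + (1 / real p ^ 3 - 1 / real p ^ 4) * (1 / real p) ^ n + 1 / real p ^ 4" for n
  proof -
    have "(1 / (real p ^ 4 * w)) ^ n * (real (alpha G n) * (real p ^ 4 * w)) =
        w * 1 + (real p * w - w) * (1 / real p) ^ n
        + (real p ^ 3 * w - real p * w) * (1 / real p ^ 2) ^ n
        + (real p ^ 4 * w - real p ^ 3 * w) * (1 / real p ^ 3) ^ n"
      unfolding alpha by (simp only: distrib_left mult.left_commute[of "(_ / _) ^ _"] ratios)
    then have "(1 / (real p ^ 4 * w)) ^ n * real (alpha G n) =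
        (w * 1 + (real p * w - w) * (1 / real p) ^ n
        + (real p ^ 3 * w - real p * w) * (1 / real p ^ 2) ^ n
        + (real p ^ 4 * w - real p ^ 3 * w) * (1 / real p ^ 3) ^ n) / (real p ^ 4 * w)"
      using p w by (simp add: field_simps)
    then show ?thesis using p w by (simp add: diff_divide_distrib add_divide_distrib
        algebra_simps power2_eq_square power3_eq_cube power4_eq_xxxx)
  qed
  \<comment> \<open>The exponent n + 1 leaves one surplus factor per term. Divided by |G| = p^4 w it
    gives the numerators: (p + 1) p^2 / p^4, (p^3 - p) p / p^4 and -p^3 / p^4.\<close>
  have B_coeff: "(1 / (real p ^ 4 * w)) ^ n * real (beta G n) =
      - (1 / real p) * (1 / real p ^ 4) ^ n + (1 - 1 / real p ^ 2) * (1 / real p ^ 3) ^ n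
      + (1 / real p + 1 / real p ^ 2) * (1 / real p ^ 2) ^ n" for n
  proof -
    have "(1 / (real p ^ 4 * w)) ^ n * (real (beta G n) * (real p ^ 4 * w)) =
        (real p + 1) * (real p ^ 2 * w) * (1 / real p ^ 2) ^ n
        + (real p ^ 3 - real p) * (real p * w) * (1 / real p ^ 3) ^ n
        - real p ^ 3 * w * (1 / real p ^ 4) ^ n"
      unfolding beta ratios[symmetric] by (simp add: algebra_simps)
    then have "(1 / (real p ^ 4 * w)) ^ n * real (beta G n) =
        ((real p + 1) * (real p ^ 2 * w) * (1 / real p ^ 2) ^ n
        + (real p ^ 3 - real p) * (real p * w) * (1 / real p ^ 3) ^ n
        - real p ^ 3 * w * (1 / real p ^ 4) ^ n) / (real p ^ 4 * w)"
      using p w by (simp add: field_simps)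
    then show ?thesis using p w by (simp add: diff_divide_distrib add_divide_distrib
        algebra_simps power2_eq_square power3_eq_cube power4_eq_xxxx)
  qed
  \<comment> \<open>The term with denominator 1 - t is the geometric series with ratio 1, which
    lacks the constant factor that \<open>fps_const_over_geometric\<close> matches on.\<close>
  have one: "fps_const c / (1 - fps_X) = Abs_fps (\<lambda>n. c)" for c :: real
    using fps_const_over_geometric[of c 1] by simp
  have powi: "real p powi (-1) = 1 / real p" "real p powi (-2) = 1 / real p ^ 2"
    "real p powi (-3) = 1 / real p ^ 3" "real p powi (-4) = 1 / real p ^ 4"
    by (simp_all add: power_int_def field_simps)
  show ?thesis
    unfolding order powi fps_compose_linear fps_const_over_geometric one
    by (simp add: fps_eq_iff A_fps_def B_fps_def A_coeff B_coeff)
qed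

end
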